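(* Let $X\neq\{0\}$ be a complex Banach space. Then: (a) $\ell_\infty$ is isomorphic to a subspace of $\mathcal H^\infty_0(B_X)$ which is contained in $\big(\mathcal H^\infty_0(B_X)\setminus \mathcal HL_0(B_X)\big)\cup\{0\}$. (b) $\ell_\infty$ is isomorphic to a subspace of $\operatorname{Lip}_0(B_X)$ which is contained in $\big(\operatorname{Lip}_0(B_X)\setminus \mathcal HL_0(B_X)\big)\cup\{0\}$.
   Context: $B_X$ is the open unit ball of $X$. $\mathcal H^\infty_0(B_X)$ is the space of bounded holomorphic functions $f:B_X\to\mathbb C$ with $f(0)=0$, with the supremum norm. $\operatorname{Lip}_0(B_X)$ is the space of Lipschitz functions $f:B_X\to\mathbb C$ with $f(0)=0$, normed by the Lipschitz constant $L(f)=\sup\{|f(x)-f(y)|/\|x-y\|:x\neq y\in B_X\}$. $\mathcal HL_0(B_X)=\operatorname{Lip}_0(B_X)\cap \mathcal H^\infty_0(B_X)$. $\ell_\infty$ is the complex Banach space of bounded complex sequences. "Isomorphic" means linearly homeomorphic, where the subspace carries the norm of $\mathcal H^\infty_0(B_X)$ (in (a)) or of $\operatorname{Lip}_0(B_X)$ (in (b)). *)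

theory Defs
  imports "HOL-Analysis.Analysis" "HOL-Library.Function_Algebras"
begin

section \<open>Complex Banach spaces\<close>

text \<open>The real structure is the restriction of the complex one to real scalars.\<close>

class complex_normed_vector = real_normed_vector +
  fixes scaleC :: "complex \<Rightarrow> 'a \<Rightarrow> 'a"  (infixr \<open>*\<^sub>C\<close> 75)
  assumes scaleC_add_right: "c *\<^sub>C (x + y) = c *\<^sub>C x + c *\<^sub>C y"
    and scaleC_add_left: "(c + d) *\<^sub>C x = c *\<^sub>C x + d *\<^sub>C x"
    and scaleC_scaleC: "c *\<^sub>C d *\<^sub>C x = (c * d) *\<^sub>C x"
    and scaleC_of_real: "complex_of_real r *\<^sub>C x = r *\<^sub>R x"
    and norm_scaleC: "norm (c *\<^sub>C x) = cmod c * norm x"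

class complex_banach = complex_normed_vector + banach

instantiation complex :: complex_banach
begin

definition scaleC_complex :: "complex \<Rightarrow> complex \<Rightarrow> complex" where
  "scaleC_complex c x = c * x"

instance
  by standard (auto simp: scaleC_complex_def algebra_simps scaleR_conv_of_real norm_mult)

end

text \<open>Holomorphy is complex Frechet differentiability at every point; it is meant for open \<open>U\<close>.\<close>

definition frechet_holomorphic_on ::
    "('a::complex_normed_vector \<Rightarrow> complex) \<Rightarrow> 'a set \<Rightarrow> bool" where
  "frechet_holomorphic_on f U \<longleftrightarrow>
     (\<forall>x\<in>U. \<exists>D. (f has_derivative D) (at x) \<and> (\<forall>c v. D (c *\<^sub>C v) = c * D v))"

lemma frechet_holomorphic_on_complex:
  fixes f :: "complex \<Rightarrow> complex"
  assumes "open U"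
  shows "frechet_holomorphic_on f U \<longleftrightarrow> f holomorphic_on U"
proof -
  have "(\<exists>D. (f has_derivative D) (at x) \<and> (\<forall>c v. D (c *\<^sub>C v) = c * D v))
      \<longleftrightarrow> f field_differentiable (at x)" for x
  proof
    assume "\<exists>D. (f has_derivative D) (at x) \<and> (\<forall>c v. D (c *\<^sub>C v) = c * D v)"
    then obtain D where D: "(f has_derivative D) (at x)" "\<And>c v. D (c * v) = c * D v"
      by (auto simp: scaleC_complex_def)
    have "D = (*) (D 1)"
    proof
      fix v
      show "D v = D 1 * v" using D(2)[of v 1] by (metis mult.commute mult.right_neutral)
    qed
    then show "f field_differentiable (at x)"
      using D(1) unfolding field_differentiable_def has_field_derivative_def by metis
  next
    assume "f field_differentiable (at x)"
    then obtain d where "(f has_derivative (*) d) (at x)"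
      unfolding field_differentiable_def has_field_derivative_def by blast
    then show "\<exists>D. (f has_derivative D) (at x) \<and> (\<forall>c v. D (c *\<^sub>C v) = c * D v)"
      by (intro exI[of _ "(*) d"]) (auto simp: scaleC_complex_def)
  qed
  moreover have "at x within U = at x" if "x \<in> U" for x
    using that assms by (rule at_within_open)
  ultimately show ?thesis
    unfolding frechet_holomorphic_on_def holomorphic_on_def by metis
qed

section \<open>Normed spaces of complex-valued functions\<close>

global_interpretation cfun: vector_space "\<lambda>(c::complex) (f::'i \<Rightarrow> complex) i. c * f i"
  by unfold_locales (auto simp: fun_eq_iff algebra_simps)

locale fun_norm =
  fixes V :: "('i \<Rightarrow> complex) set" and N :: "('i \<Rightarrow> complex) \<Rightarrow> real"
  assumes subspace: "cfun.subspace V"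
    and norm_nonneg: "f \<in> V \<Longrightarrow> 0 \<le> N f"
    and norm_eq_0: "f \<in> V \<Longrightarrow> N f = 0 \<Longrightarrow> f = 0"
    and norm_scale: "f \<in> V \<Longrightarrow> N (\<lambda>i. c * f i) = cmod c * N f"
    and norm_triangle: "f \<in> V \<Longrightarrow> g \<in> V \<Longrightarrow> N (f + g) \<le> N f + N g"

text \<open>
  The locale \<open>Metric_space\<close> demands nonnegativity and symmetry of the distance also outside of the
  carrier, where a supremum norm is an unspecified value; hence the truncation.
\<close>

definition norm_dist ::
    "('i \<Rightarrow> complex) set \<Rightarrow> (('i \<Rightarrow> complex) \<Rightarrow> real)
      \<Rightarrow> ('i \<Rightarrow> complex) \<Rightarrow> ('i \<Rightarrow> complex) \<Rightarrow> real" where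
  "norm_dist V N f g = (if f \<in> V \<and> g \<in> V then N (f - g) else 0)"

definition norm_topology ::
    "('i \<Rightarrow> complex) set \<Rightarrow> (('i \<Rightarrow> complex) \<Rightarrow> real) \<Rightarrow> ('i \<Rightarrow> complex) topology" where
  "norm_topology V N = Metric_space.mtopology V (norm_dist V N)"

definition isomorphic ::
    "('i \<Rightarrow> complex) set \<Rightarrow> (('i \<Rightarrow> complex) \<Rightarrow> real)
      \<Rightarrow> ('j \<Rightarrow> complex) set \<Rightarrow> (('j \<Rightarrow> complex) \<Rightarrow> real) \<Rightarrow> bool" where
  "isomorphic V N W N' \<longleftrightarrow>
     (\<exists>T. (\<forall>f\<in>V. \<forall>g\<in>V. T (f + g) = T f + T g) \<and>
          (\<forall>c. \<forall>f\<in>V. T (\<lambda>i. c * f i) = (\<lambda>j. c * T f j)) \<and>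
          homeomorphic_map (norm_topology V N) (norm_topology W N') T)"

context fun_norm
begin

lemma Metric_space_norm_dist: "Metric_space V (norm_dist V N)"
proof
  fix f g
  have D: "f - g \<in> V" if "f \<in> V" "g \<in> V" for f g
    using cfun.subspace_diff[OF subspace that] .
  show "0 \<le> norm_dist V N f g"
    using D norm_nonneg by (auto simp: norm_dist_def)
  show "norm_dist V N f g = norm_dist V N g f"
  proof (cases "f \<in> V \<and> g \<in> V")
    case True
    have "(\<lambda>i. - 1 * (f - g) i) = g - f" by (auto simp: fun_eq_iff)
    then have "N (g - f) = N (f - g)"
      using norm_scale[OF D, of f g "-1"] True by simp
    then show ?thesis using True by (simp add: norm_dist_def)
  qed (auto simp: norm_dist_def)
  have "N 0 = 0"
    using norm_scale[OF cfun.subspace_0[OF subspace], of 0] by (simp add: zero_fun_def)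
  then show "(norm_dist V N f g = 0) = (f = g)" if "f \<in> V" "g \<in> V"
    using that norm_eq_0[OF D[OF that]] by (auto simp: norm_dist_def)
  show "norm_dist V N f h \<le> norm_dist V N f g + norm_dist V N g h"
    if "f \<in> V" "g \<in> V" "h \<in> V" for h
  proof -
    have "(f - g) + (g - h) = f - h" by simp
    then show ?thesis
      using that norm_triangle[OF D[of f g] D[of g h]] by (simp add: norm_dist_def)
  qed
qed

lemma fun_norm_subspace:
  assumes "cfun.subspace M" "M \<subseteq> V"
  shows "fun_norm M N"
  by unfold_locales (use assms in \<open>simp_all add: subset_iff norm_nonneg norm_eq_0 norm_scale norm_triangle\<close>)

end

section \<open>The spaces\<close>

definition linf :: "(nat \<Rightarrow> complex) set" where
  "linf = {s. bounded (range s)}"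

definition linf_norm :: "(nat \<Rightarrow> complex) \<Rightarrow> real" where
  "linf_norm s = (SUP n. cmod (s n))"

text \<open>
  A function on the open unit ball is represented by its extension by zero to the whole type;
  this makes the representation unique and compatible with pointwise operations.
\<close>

definition ball_fun :: "('a::complex_normed_vector \<Rightarrow> complex) set" where
  "ball_fun = {f. \<forall>x. x \<notin> ball 0 1 \<longrightarrow> f x = 0}"

definition Hinf0 :: "('a::complex_normed_vector \<Rightarrow> complex) set" where
  "Hinf0 = {f \<in> ball_fun. frechet_holomorphic_on f (ball 0 1) \<and>
              bounded (f ` ball 0 1) \<and> f 0 = 0}"

definition sup_norm :: "('a::complex_normed_vector \<Rightarrow> complex) \<Rightarrow> real" where
  "sup_norm f = (SUP x\<in>ball 0 1. cmod (f x))"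

definition Lip0 :: "('a::complex_normed_vector \<Rightarrow> complex) set" where
  "Lip0 = {f \<in> ball_fun. (\<exists>L. L-lipschitz_on (ball 0 1) f) \<and> f 0 = 0}"

definition Lip_norm :: "('a::complex_normed_vector \<Rightarrow> complex) \<Rightarrow> real" where
  "Lip_norm f =
     Sup {cmod (f x - f y) / norm (x - y) | x y. x \<in> ball 0 1 \<and> y \<in> ball 0 1 \<and> x \<noteq> y}"

definition HL0 :: "('a::complex_normed_vector \<Rightarrow> complex) set" where
  "HL0 = Lip0 \<inter> Hinf0"

section \<open>The spaces are normed spaces\<close>

lemma SUP_mult_left_real:
  fixes h :: "'i \<Rightarrow> real"
  assumes "A \<noteq> {}" "bdd_above (h ` A)" "0 \<le> a"
  shows "(SUP i\<in>A. a * h i) = a * (SUP i\<in>A. h i)"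
proof -
  have "continuous (at_left (Sup (h ` A))) ((*) a)" by (intro continuous_intros)
  then show ?thesis
    using continuous_at_Sup_mono[of "(*) a" "h ` A"] assms
    by (simp add: mono_def mult_left_mono image_image)
qed

lemma frechet_holomorphic_on_add:
  assumes "frechet_holomorphic_on f U" "frechet_holomorphic_on g U"
  shows "frechet_holomorphic_on (\<lambda>x. f x + g x) U"
  unfolding frechet_holomorphic_on_def
proof
  fix x assume "x \<in> U"
  then obtain D E where "(f has_derivative D) (at x)" "\<And>c v. D (c *\<^sub>C v) = c * D v"
      "(g has_derivative E) (at x)" "\<And>c v. E (c *\<^sub>C v) = c * E v"
    using assms unfolding frechet_holomorphic_on_def by metis
  then show "\<exists>D. ((\<lambda>x. f x + g x) has_derivative D) (at x) \<and> (\<forall>c v. D (c *\<^sub>C v) = c * D v)"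
    by (intro exI[of _ "\<lambda>v. D v + E v"] conjI has_derivative_add) (auto simp: algebra_simps)
qed

lemma frechet_holomorphic_on_cmult:
  assumes "frechet_holomorphic_on f U"
  shows "frechet_holomorphic_on (\<lambda>x. a * f x) U"
  unfolding frechet_holomorphic_on_def
proof
  fix x assume "x \<in> U"
  then obtain D where "(f has_derivative D) (at x)" "\<And>c v. D (c *\<^sub>C v) = c * D v"
    using assms unfolding frechet_holomorphic_on_def by metis
  then show "\<exists>D. ((\<lambda>x. a * f x) has_derivative D) (at x) \<and> (\<forall>c v. D (c *\<^sub>C v) = c * D v)"
    by (intro exI[of _ "\<lambda>v. a * D v"] conjI has_derivative_mult_right) (auto simp: algebra_simps)
qed

lemma frechet_holomorphic_on_0: "frechet_holomorphic_on (\<lambda>x. 0) U"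
  unfolding frechet_holomorphic_on_def by (intro ballI exI[of _ "\<lambda>v. 0"]) auto

lemma bdd_above_cmod: "bounded (f ` A) \<Longrightarrow> bdd_above ((\<lambda>i. cmod (f i)) ` A)"
  by (auto simp: bounded_iff bdd_above_def)

lemma fun_norm_linf: "fun_norm linf linf_norm"
proof
  show "cfun.subspace linf"
    by (auto simp: cfun.subspace_def linf_def bounded_plus_comp bounded_iff zero_fun_def norm_mult)
       (meson norm_triangle_le add_mono order_trans, meson mult_left_mono norm_ge_zero)
  fix f :: "nat \<Rightarrow> complex" assume f: "f \<in> linf"
  then have b: "bdd_above (range (\<lambda>i. cmod (f i)))" by (auto simp: linf_def intro: bdd_above_cmod)
  have le: "cmod (f n) \<le> linf_norm f" for n
    unfolding linf_norm_def by (rule cSUP_upper[OF _ b]) simp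
  show "0 \<le> linf_norm f" using le[of 0] norm_ge_zero order_trans by blast
  show "f = 0" if "linf_norm f = 0" using le that by (auto simp: fun_eq_iff)
  show "linf_norm (\<lambda>i. c * f i) = cmod c * linf_norm f" for c
    unfolding linf_norm_def norm_mult by (rule SUP_mult_left_real[OF _ b]) auto
  fix g :: "nat \<Rightarrow> complex" assume g: "g \<in> linf"
  then have b: "bdd_above (range (\<lambda>i. cmod (g i)))" by (auto simp: linf_def intro: bdd_above_cmod)
  have le': "cmod (g n) \<le> linf_norm g" for n
    unfolding linf_norm_def by (rule cSUP_upper[OF _ b]) simp
  show "linf_norm (f + g) \<le> linf_norm f + linf_norm g"
    unfolding linf_norm_def[of "f+g"]
    by (rule cSUP_least) (auto intro: order_trans[OF norm_triangle_ineq add_mono[OF le le']])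
qed

lemma fun_norm_Hinf0: "fun_norm Hinf0 sup_norm"
proof
  have "bounded ((\<lambda>x. c * f x) ` ball 0 1)" if "bounded (f ` ball 0 1)" for c and f :: "'a \<Rightarrow> complex"
    using bounded_linear_image[OF that bounded_linear_mult_right[of c]] by (simp add: image_image)
  then show "cfun.subspace (Hinf0 :: ('a \<Rightarrow> complex) set)"
    unfolding cfun.subspace_def
    by (simp add: Hinf0_def ball_fun_def zero_fun_def plus_fun_def
        frechet_holomorphic_on_0 frechet_holomorphic_on_add frechet_holomorphic_on_cmult
        bounded_plus_comp image_constant_conv)
  fix f :: "'a \<Rightarrow> complex" assume f: "f \<in> Hinf0"
  then have b: "bdd_above ((\<lambda>i. cmod (f i)) ` ball 0 1)" by (auto simp: Hinf0_def intro: bdd_above_cmod)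
  have le: "cmod (f n) \<le> sup_norm f" if "n \<in> ball 0 1" for n
    unfolding sup_norm_def by (rule cSUP_upper[OF that b])
  show "0 \<le> sup_norm f" by (rule order_trans[OF norm_ge_zero le[of 0]]) simp
  show "f = 0" if "sup_norm f = 0"
  proof
    fix x show "f x = 0 x" using le[of x] that f by (cases "x \<in> ball 0 1") (auto simp: Hinf0_def ball_fun_def)
  qed
  show "sup_norm (\<lambda>i. c * f i) = cmod c * sup_norm f" for c
    unfolding sup_norm_def norm_mult by (rule SUP_mult_left_real[OF _ b]) auto
  fix g :: "'a \<Rightarrow> complex" assume g: "g \<in> Hinf0"
  then have b: "bdd_above ((\<lambda>i. cmod (g i)) ` ball 0 1)" by (auto simp: Hinf0_def intro: bdd_above_cmod)
  have le': "cmod (g n) \<le> sup_norm g" if "n \<in> ball 0 1" for n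
    unfolding sup_norm_def by (rule cSUP_upper[OF that b])
  show "sup_norm (f + g) \<le> sup_norm f + sup_norm g"
    unfolding sup_norm_def[of "f+g"]
    by (rule cSUP_least) (auto intro: order_trans[OF norm_triangle_ineq add_mono[OF le le']])
qed
lemma fun_norm_Lip0:
  assumes "\<exists>x::'a::complex_normed_vector. x \<noteq> 0"
  shows "fun_norm (Lip0 :: ('a \<Rightarrow> complex) set) Lip_norm"
proof -
  define P where "P = {(x::'a,y). x \<in> ball 0 1 \<and> y \<in> ball 0 1 \<and> x \<noteq> y}"
  define q where "q f p = cmod (f (fst p) - f (snd p)) / norm (fst p - snd p)" for f and p :: "'a \<times> 'a"
  have L: "Lip_norm f = (SUP p\<in>P. q f p)" for f :: "'a \<Rightarrow> complex"
    unfolding Lip_norm_def by (rule arg_cong[where f=Sup]) (force simp: P_def q_def image_iff)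
  obtain x :: 'a where "x \<noteq> 0" using assms by blast
  then have "((1 / (2 * norm x)) *\<^sub>R x, 0) \<in> P" by (auto simp: P_def)
  then have P: "P \<noteq> {}" by blast
  have lip: "(\<exists>L. L-lipschitz_on (ball 0 1) f) \<longleftrightarrow> bdd_above (q f ` P)" for f
  proof
    assume "\<exists>L. L-lipschitz_on (ball 0 1) f"
    then obtain C where "C-lipschitz_on (ball 0 1) f" by blast
    then show "bdd_above (q f ` P)"
      by (intro bdd_aboveI[of _ C]) (auto simp: P_def q_def lipschitz_on_def dist_norm divide_simps)
  next
    assume "bdd_above (q f ` P)"
    then obtain C where C: "\<And>p. p \<in> P \<Longrightarrow> q f p \<le> C" by (auto simp: bdd_above_def)
    have "\<bar>C\<bar>-lipschitz_on (ball 0 1) f"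
    proof (rule lipschitz_onI)
      fix x y :: 'a assume xy: "x \<in> ball 0 1" "y \<in> ball 0 1"
      show "dist (f x) (f y) \<le> \<bar>C\<bar> * dist x y"
      proof (cases "x = y")
        case False
        then have "q f (x,y) \<le> C" using C xy by (auto simp: P_def)
        then have "q f (x,y) \<le> \<bar>C\<bar>" by linarith
        then show ?thesis using False by (simp add: q_def dist_norm divide_simps)
      qed auto
    qed auto
    then show "\<exists>L. L-lipschitz_on (ball 0 1) f" by blast
  qed
  have qs: "q (\<lambda>i. c * f i) p = cmod c * q f p" for c f p
    by (simp add: q_def norm_mult flip: right_diff_distrib)
  have qt: "q (f + g) p \<le> q f p + q g p" for f g p
  proof -
    have "cmod ((f + g) (fst p) - (f + g) (snd p)) \<le> cmod (f (fst p) - f (snd p)) + cmod (g (fst p) - g (snd p))"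
      using norm_triangle_ineq[of "f (fst p) - f (snd p)" "g (fst p) - g (snd p)"] by (simp add: algebra_simps)
    then show ?thesis unfolding q_def add_divide_distrib[symmetric] by (rule divide_right_mono) simp
  qed
  have b: "bdd_above (q f ` P)" if "f \<in> Lip0" for f using that lip by (auto simp: Lip0_def)
  have le: "q f p \<le> Lip_norm f" if "f \<in> Lip0" "p \<in> P" for f p
    unfolding L by (rule cSUP_upper[OF that(2) b[OF that(1)]])
  show ?thesis
  proof
    have "bdd_above (q 0 ` P)" by (auto simp: q_def)
    moreover have "bdd_above (q (f+g) ` P)" if "bdd_above (q f ` P)" "bdd_above (q g ` P)" for f g
      using that qt unfolding bdd_above_def by simp (meson add_mono order_trans)
    moreover have "bdd_above (q (\<lambda>i. c * f i) ` P)" if "bdd_above (q f ` P)" for c f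
      using that unfolding bdd_above_def qs by simp (meson mult_left_mono norm_ge_zero)
    ultimately show "cfun.subspace (Lip0 :: ('a \<Rightarrow> complex) set)"
      unfolding cfun.subspace_def Lip0_def lip by (simp add: ball_fun_def)
    fix f g :: "'a \<Rightarrow> complex" assume f: "f \<in> Lip0"
    obtain p where p: "p \<in> P" using P by blast
    show "0 \<le> Lip_norm f" using le[OF f p] by (rule order_trans[rotated]) (simp add: q_def)
    show "f = 0" if "Lip_norm f = 0"
    proof
      fix x show "f x = 0 x"
      proof (cases "x \<in> ball 0 1 \<and> x \<noteq> 0")
        case True
        then have "q f (x,0) \<le> 0" using le[OF f, of "(x,0)"] that by (auto simp: P_def)
        then show ?thesis using True f by (auto simp: q_def Lip0_def divide_le_0_iff)
      qed (use f in \<open>auto simp: Lip0_def ball_fun_def\<close>)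
    qed
    show "Lip_norm (\<lambda>i. c * f i) = cmod c * Lip_norm f" for c
      unfolding L qs by (rule SUP_mult_left_real[OF P b[OF f]]) auto
    show "Lip_norm (f + g) \<le> Lip_norm f + Lip_norm g" if g: "g \<in> Lip0"
      unfolding L[of "f+g"]
      by (rule cSUP_least[OF P]) (auto intro: order_trans[OF qt add_mono[OF le[OF f] le[OF g]]])
  qed
qed
end

theory Submission
  imports Defs "HOL-Complex_Analysis.Complex_Analysis"
begin

text \<open>
  In both parts a bounded sequence \<open>s\<close> is mapped linearly to a function on the ball whose norm is
  comparable to that of \<open>s\<close> and from whose bad behaviour every entry \<open>s k\<close> can be read off. A
  linear map that is bounded above and below is an isomorphism onto its image
  (\<open>isomorphic_image\<close>), so it remains to give the two maps.

  For part (a), fix a unit vector \<open>x0\<close> and, by the Hahn-Banach theorem, a complex linear functional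
  \<open>\<phi>\<close> of norm \<open>1\<close> with \<open>\<phi> x0 = 1\<close> (\<open>norming_functional\<close>). Then \<open>w = 1 - \<phi> x\<close> lies in the right
  half-plane for \<open>x\<close> in the ball, and \<open>x \<rightarrow> x0\<close> implies \<open>w \<rightarrow> 0\<close>. In the half-plane the rational
  functions \<open>4 t w / (t + w)\<^sup>2\<close> are bumps of height \<open>1\<close> at the point \<open>t\<close>. If the scales
  \<open>t n\<close> decrease fast enough, then the sum of the moduli of the bumps is bounded on the
  half-plane by a telescoping estimate (\<open>sum_bump_le\<close>), and \<open>\<Sum>n. a n \<sqdot> bump (t n) w\<close> takes
  at \<open>t m\<close> a value that differs from \<open>a m\<close> by an amount that tends to \<open>0\<close>
  (\<open>bump_series_at_knot\<close>). Let the coefficients \<open>a\<close> run infinitely often through every entry of \<open>s\<close>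
  and through \<open>0\<close>. Then every \<open>s k\<close> and \<open>0\<close> are cluster values at the boundary point \<open>x0\<close>.
  Hence the supremum norm is at least that of \<open>s\<close>, and if the function is Lipschitz, so that it
  has a limit at \<open>x0\<close>, then all \<open>s k\<close> equal \<open>0\<close> (\<open>bump_fun_not_Lipschitz\<close>).

  For part (b), put disjoint tents of slope \<open>\<plusminus> s n\<close> on the interval from \<open>0\<close> to \<open>1\<close> and compose
  their sum with the norm. Disjointness bounds the Lipschitz constant by twice the norm of \<open>s\<close>
  (\<open>tent_sum_lipschitz\<close>), the slopes along a ray bound it from below, and if \<open>s n \<noteq> 0\<close>, then the
  kink at the top of the \<open>n\<close>-th tent excludes even real differentiability
  (\<open>tent_fun_not_holomorphic\<close>).
\<close>

section \<open>Isomorphic embeddings\<close>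

lemma continuous_map_norm_topology:
  assumes "fun_norm V N" "fun_norm W N'" "0 < C"
    and "\<And>f. f \<in> V \<Longrightarrow> T f \<in> W"
    and "\<And>f g. f \<in> V \<Longrightarrow> g \<in> V \<Longrightarrow> N' (T f - T g) \<le> C * N (f - g)"
  shows "continuous_map (norm_topology V N) (norm_topology W N') T"
proof -
  interpret V: Metric_space V "norm_dist V N"
    using assms(1) by (rule fun_norm.Metric_space_norm_dist)
  have W: "Metric_space W (norm_dist W N')"
    using assms(2) by (rule fun_norm.Metric_space_norm_dist)
  show ?thesis
    unfolding norm_topology_def V.metric_continuous_map[OF W]
  proof (intro conjI ballI allI impI)
    show "T ` V \<subseteq> W" using assms(4) by blast
    fix f and e :: real assume f: "f \<in> V" and e: "e > 0"
    have "norm_dist W N' (T f) (T g) < e" if g: "g \<in> V" "norm_dist V N f g < e / C" for g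
    proof -
      have "C * N (f - g) < e" using g f \<open>0 < C\<close> by (simp add: norm_dist_def field_simps)
      then show ?thesis using assms(4)[OF f] assms(4)[OF g(1)] assms(5)[OF f g(1)]
        by (simp add: norm_dist_def)
    qed
    then show "\<exists>d>0. \<forall>g. g \<in> V \<and> norm_dist V N f g < d \<longrightarrow> norm_dist W N' (T f) (T g) < e"
      using e \<open>0 < C\<close> by (intro exI[of _ "e / C"]) auto
  qed
qed

text \<open>
  A linear map that is bounded above and below is a homeomorphism onto its image, by Lipschitz
  continuity in both directions. Both parts of the theorem reduce to finding such a map on \<open>linf\<close>.
\<close>

lemma isomorphic_image:
  assumes V: "fun_norm V N" and W: "fun_norm W N'"
    and TW: "\<And>f. f \<in> V \<Longrightarrow> T f \<in> W"
    and add: "\<And>f g. f \<in> V \<Longrightarrow> g \<in> V \<Longrightarrow> T (f + g) = T f + T g"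
    and scale: "\<And>c f. f \<in> V \<Longrightarrow> T (\<lambda>i. c * f i) = (\<lambda>j. c * T f j)"
    and upper: "\<And>f. f \<in> V \<Longrightarrow> N' (T f) \<le> C * N f" and "0 < C"
    and lower: "\<And>f. f \<in> V \<Longrightarrow> N f \<le> N' (T f)"
  shows "cfun.subspace (T ` V)" and "isomorphic V N (T ` V) N'"
proof -
  note sub = fun_norm.subspace[OF V]
  have T0: "T 0 = 0"
    using scale[OF cfun.subspace_0[OF sub], of 0] by (simp add: zero_fun_def)
  show sub': "cfun.subspace (T ` V)"
    unfolding cfun.subspace_def
  proof (intro conjI ballI allI)
    show "0 \<in> T ` V" using T0 cfun.subspace_0[OF sub] by force
    show "x + y \<in> T ` V" if "x \<in> T ` V" "y \<in> T ` V" for x y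
    proof -
      obtain f where f: "f \<in> V" "x = T f" using \<open>x \<in> T ` V\<close> by (rule imageE)
      obtain g where g: "g \<in> V" "y = T g" using \<open>y \<in> T ` V\<close> by (rule imageE)
      then have "x + y = T (f + g)" using add f by simp
      then show ?thesis using cfun.subspace_add[OF sub f(1) g(1)] by (rule image_eqI)
    qed
    show "(\<lambda>i. c * x i) \<in> T ` V" if "x \<in> T ` V" for c x
    proof -
      obtain f where f: "f \<in> V" "x = T f" using \<open>x \<in> T ` V\<close> by (rule imageE)
      then have "(\<lambda>i. c * x i) = T (\<lambda>i. c * f i)" using scale by simp
      then show ?thesis using cfun.subspace_scale[OF sub f(1)] by (rule image_eqI)
    qed
  qed
  have W': "fun_norm (T ` V) N'"
    using fun_norm.fun_norm_subspace[OF W sub'] TW by blast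
  have diff: "T (f - g) = T f - T g" "f - g \<in> V" if "f \<in> V" "g \<in> V" for f g
  proof -
    show *: "f - g \<in> V" using cfun.subspace_diff[OF sub that] .
    have "T ((f - g) + g) = T (f - g) + T g" by (rule add[OF * that(2)])
    then show "T (f - g) = T f - T g" by simp
  qed
  have inj: "inj_on T V"
  proof (rule inj_onI)
    fix f g assume fg: "f \<in> V" "g \<in> V" and "T f = T g"
    then have "T (f - g) = T 0" using diff T0 by simp
    then have "N (f - g) \<le> N' (T 0)" using lower[OF diff(2)[OF fg]] by simp
    also have "\<dots> \<le> C * N 0" using upper cfun.subspace_0[OF sub] by blast
    also have "N 0 = 0"
      using fun_norm.norm_scale[OF V cfun.subspace_0[OF sub], of 0] by (simp add: zero_fun_def)
    finally have "N (f - g) = 0" using fun_norm.norm_nonneg[OF V diff(2)[OF fg]] by linarith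
    then have "f - g = 0" by (rule fun_norm.norm_eq_0[OF V diff(2)[OF fg]])
    then show "f = g" by simp
  qed
  have "homeomorphic_maps (norm_topology V N) (norm_topology (T ` V) N') T (inv_into V T)"
    unfolding homeomorphic_maps_def
  proof (intro conjI)
    show "continuous_map (norm_topology V N) (norm_topology (T ` V) N') T"
      using upper diff \<open>0 < C\<close> by (intro continuous_map_norm_topology[OF V W', of C]) force+
    show "continuous_map (norm_topology (T ` V) N') (norm_topology V N) (inv_into V T)"
    proof (rule continuous_map_norm_topology[OF W' V, of 1])
      fix x y assume "x \<in> T ` V" "y \<in> T ` V"
      then obtain f g where fg: "f \<in> V" "g \<in> V" and [simp]: "x = T f" "y = T g" by blast
      show "N (inv_into V T x - inv_into V T y) \<le> 1 * N' (x - y)"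
        using lower[OF diff(2)[OF fg]] diff(1)[OF fg] fg by (simp add: inv_into_f_f[OF inj])
    qed (auto intro: inv_into_into)
    have "topspace (norm_topology V N) = V" "topspace (norm_topology (T ` V) N') = T ` V"
      using fun_norm.Metric_space_norm_dist[OF V] fun_norm.Metric_space_norm_dist[OF W']
      by (simp_all add: norm_topology_def Metric_space.topspace_mtopology)
    then show "\<forall>x\<in>topspace (norm_topology V N). inv_into V T (T x) = x"
        "\<forall>y\<in>topspace (norm_topology (T ` V) N'). T (inv_into V T y) = y"
      by (auto simp: inv_into_f_f[OF inj] f_inv_into_f)
  qed
  then have "homeomorphic_map (norm_topology V N) (norm_topology (T ` V) N') T"
    by (metis homeomorphic_maps_map)
  then show "isomorphic V N (T ` V) N'"
    unfolding isomorphic_def using add scale by blast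
qed

section \<open>Norming functionals\<close>

text \<open>
  The functional is found among sublinear ones: a pointwise minimal sublinear functional is linear.
  Working with functionals on the whole space avoids partially defined extensions in the
  application of Zorn's lemma.
\<close>

definition sublinear :: "('a::real_vector \<Rightarrow> real) \<Rightarrow> bool" where
  "sublinear p \<longleftrightarrow> (\<forall>x y. p (x + y) \<le> p x + p y) \<and> (\<forall>c x. 0 \<le> c \<longrightarrow> p (c *\<^sub>R x) = c * p x)"

lemma sublinearI:
  assumes add: "\<And>x y. p (x + y) \<le> p x + p y" and "p 0 = 0"
    and scale: "\<And>c x. 0 < c \<Longrightarrow> p (c *\<^sub>R x) \<le> c * p x"
  shows "sublinear p"
  unfolding sublinear_def
proof (intro conjI allI impI add)
  fix c :: real and x :: 'a assume "0 \<le> c"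
  show "p (c *\<^sub>R x) = c * p x"
  proof (cases "c = 0")
    case False
    then have c: "0 < c" using \<open>0 \<le> c\<close> by simp
    have "p ((1/c) *\<^sub>R (c *\<^sub>R x)) \<le> (1/c) * p (c *\<^sub>R x)" using c by (intro scale) simp
    then have "c * p x \<le> p (c *\<^sub>R x)" using c by (simp add: field_simps)
    then show ?thesis using scale[OF c, of x] by simp
  qed (simp add: assms)
qed

lemma sublinear_add: "sublinear p \<Longrightarrow> p (x + y) \<le> p x + p y"
  and sublinear_scale: "sublinear p \<Longrightarrow> 0 \<le> c \<Longrightarrow> p (c *\<^sub>R x) = c * p x"
  by (auto simp: sublinear_def)

lemma sublinear_0: "sublinear p \<Longrightarrow> p 0 = 0"
  using sublinear_scale[of p 0 0] by simp

lemma sublinear_ge: "sublinear p \<Longrightarrow> - p (- x) \<le> p x"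
  using sublinear_add[of p x "- x"] sublinear_0[of p] by simp

text \<open>
  The functional \<open>q x = inf {p (x + t y) - t p y | t \<ge> 0}\<close> is the result of pushing \<open>p\<close> down
  in the direction \<open>y\<close>; it is bounded below because \<open>p (t y) \<le> p (x + t y) + p (- x)\<close>.
  The two bounds on \<open>q\<close> are the cases \<open>t = 0\<close> and \<open>t = 1\<close>.
\<close>

lemma sublinear_lower:
  assumes p: "sublinear p"
  obtains q where "sublinear q" "\<And>x. q x \<le> p x" "\<And>x. q x \<le> p (x + y) - p y"
proof
  define h where "h x t = p (x + t *\<^sub>R y) - t * p y" for x t
  define q where "q x = (INF t\<in>{0..}. h x t)" for x
  have lb: "- p (- x) \<le> h x t" if "0 \<le> t" for x t
    using sublinear_add[OF p, of "x + t *\<^sub>R y" "- x"] sublinear_scale[OF p that, of y]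
    by (simp add: h_def)
  then have bdd: "bdd_below (h x ` {0..})" for x by (intro bdd_belowI[of _ "- p (- x)"]) auto
  have le: "q x \<le> h x t" if "0 \<le> t" for x t
    unfolding q_def using that by (intro cINF_lower bdd) auto
  have ge: "b \<le> q x" if "\<And>t. 0 \<le> t \<Longrightarrow> b \<le> h x t" for b x
    unfolding q_def using that by (intro cINF_greatest) auto
  show "q x \<le> p x" for x using le[of 0 x] by (simp add: h_def)
  show "q x \<le> p (x + y) - p y" for x using le[of 1 x] by (simp add: h_def)
  show "sublinear q"
  proof (rule sublinearI)
    fix x z
    have *: "q (x + z) \<le> h x s + h z t" if "0 \<le> s" "0 \<le> t" for s t
    proof -
      have "q (x + z) \<le> h (x + z) (s + t)" using that by (intro le) simp
      also have "\<dots> \<le> h x s + h z t"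
        using sublinear_add[OF p, of "x + s *\<^sub>R y" "z + t *\<^sub>R y"] by (simp add: h_def algebra_simps)
      finally show ?thesis .
    qed
    have "q (x + z) - h z t \<le> q x" if "0 \<le> t" for t
      using *[OF _ that] by (intro ge) (simp add: diff_le_eq)
    then have "q (x + z) - q x \<le> q z" by (intro ge) (simp add: algebra_simps)
    then show "q (x + z) \<le> q x + q z" by simp
  next
    have "q 0 \<le> 0" using le[of 0 0] sublinear_0[OF p] by (simp add: h_def)
    moreover have "0 \<le> q 0" using lb[of _ 0] sublinear_0[OF p] by (intro ge) simp
    ultimately show "q 0 = 0" by simp
  next
    fix c :: real and x assume c: "0 < c"
    have "q (c *\<^sub>R x) / c \<le> h x t" if "0 \<le> t" for t
    proof -
      have "q (c *\<^sub>R x) \<le> h (c *\<^sub>R x) (c * t)" using c that by (intro le) simp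
      also have "\<dots> = c * h x t"
        using sublinear_scale[OF p, of c "x + t *\<^sub>R y"] c by (simp add: h_def algebra_simps)
      finally show ?thesis using c by (simp add: field_simps)
    qed
    then have "q (c *\<^sub>R x) / c \<le> q x" by (intro ge)
    then show "q (c *\<^sub>R x) \<le> c * q x" using c by (simp add: field_simps)
  qed
qed

text \<open>
  Zorn's lemma for the reversed pointwise order on the sublinear functionals below \<open>p\<close>. The infimum
  of a chain is finite, since every member is at least \<open>- p (- x)\<close> at \<open>x\<close>, and it is subadditive
  because of two members of a chain one lies below the other.
\<close>

lemma minimal_sublinear:
  fixes p :: "'a::real_vector \<Rightarrow> real"
  assumes p: "sublinear p"
  obtains q where "sublinear q" "\<And>x. q x \<le> p x"
    and "\<And>r. sublinear r \<Longrightarrow> (\<And>x. r x \<le> q x) \<Longrightarrow> r = q"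
proof -
  define A where "A = {q. sublinear q \<and> (\<forall>x. q x \<le> p x)}"
  define P where "P = (\<lambda>a b :: 'a \<Rightarrow> real. b \<le> a)"
  have "\<exists>m\<in>A. \<forall>a\<in>A. P m a \<longrightarrow> a = m"
  proof (rule predicate_Zorn)
    show "partial_order_on A (relation_of P A)"
      by (rule partial_order_on_relation_ofI) (auto simp: P_def)
  next
    fix C assume C: "C \<in> Chains (relation_of P A)"
    then have CA: "C \<subseteq> A" by (auto simp: Chains_def relation_of_def)
    have ch: "a \<le> b \<or> b \<le> a" if "a \<in> C" "b \<in> C" for a b
      using C that by (auto simp: Chains_def relation_of_def P_def)
    show "\<exists>u\<in>A. \<forall>a\<in>C. P a u"
    proof (cases "C = {}")
      case True
      then show ?thesis using p by (auto simp: A_def)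
    next
      case ne: False
      define u where "u x = (INF a\<in>C. a x)" for x
      have lb: "- p (- x) \<le> a x" if "a \<in> C" for a x
      proof -
        have "sublinear a" "a (- x) \<le> p (- x)" using that CA by (auto simp: A_def)
        then show ?thesis using sublinear_ge[of a x] by simp
      qed
      have le: "u x \<le> a x" if "a \<in> C" for a x
        unfolding u_def using that lb by (intro cINF_lower bdd_belowI[of _ "- p (- x)"]) auto
      have ge: "b \<le> u x" if "\<And>a. a \<in> C \<Longrightarrow> b \<le> a x" for b x
        unfolding u_def using that ne by (intro cINF_greatest)
      have subl: "sublinear a" if "a \<in> C" for a using that CA by (auto simp: A_def)
      have "sublinear u"
      proof (rule sublinearI)
        fix x y
        \<comment> \<open>The smaller of the two members serves both summands.\<close>
        have *: "u (x + y) \<le> a x + b y" if ab: "a \<in> C" "b \<in> C" for a b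
        proof -
          obtain m where m: "m \<in> C" "m \<le> a" "m \<le> b" using ch[OF ab] ab by blast
          have "u (x + y) \<le> m (x + y)" using le[OF m(1)] .
          also have "\<dots> \<le> m x + m y" using sublinear_add[OF subl[OF m(1)]] .
          also have "\<dots> \<le> a x + b y" using m by (intro add_mono) (auto simp: le_fun_def)
          finally show ?thesis .
        qed
        have "u (x + y) - b y \<le> u x" if "b \<in> C" for b
          using *[OF _ that] by (intro ge) (simp add: diff_le_eq)
        then have "u (x + y) - u x \<le> u y" by (intro ge) (simp add: algebra_simps)
        then show "u (x + y) \<le> u x + u y" by simp
      next
        have "(\<lambda>a. a 0) ` C = {0}" using ne sublinear_0[OF subl] by force
        then show "u 0 = 0" by (simp add: u_def)
      next
        fix c :: real and x assume c: "0 < c"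
        have "u (c *\<^sub>R x) / c \<le> a x" if "a \<in> C" for a
          using le[OF that, of "c *\<^sub>R x"] sublinear_scale[OF subl[OF that], of c x] c
          by (simp add: field_simps)
        then have "u (c *\<^sub>R x) / c \<le> u x" by (rule ge)
        then show "u (c *\<^sub>R x) \<le> c * u x" using c by (simp add: field_simps)
      qed
      moreover have "u x \<le> p x" for x
      proof -
        obtain a where "a \<in> C" using ne by blast
        moreover have "a x \<le> p x" using \<open>a \<in> C\<close> CA by (auto simp: A_def)
        ultimately show ?thesis using le[of a x] by simp
      qed
      ultimately show ?thesis using le by (auto simp: A_def P_def le_fun_def)
    qed
  qed
  then obtain q where q: "q \<in> A" "\<And>r. r \<in> A \<Longrightarrow> r \<le> q \<Longrightarrow> r = q" unfolding P_def by blast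
  show thesis
  proof
    show "sublinear q" "\<And>x. q x \<le> p x" using q(1) by (auto simp: A_def)
    fix r assume r: "sublinear r" "\<And>x. r x \<le> q x"
    then have "r \<in> A" using q(1) order_trans by (fastforce simp: A_def)
    then show "r = q" using q(2) r(2) by (simp add: le_fun_def)
  qed
qed

text \<open>
  A minimal \<open>u\<close> cannot be pushed down in any direction, and \<open>u x \<le> u (x + y) - u y\<close> is then the
  missing half of additivity. Pushing \<open>p\<close> down in the direction \<open>x0\<close> before minimising forces
  \<open>u (- x0) \<le> - p x0\<close>, so that \<open>u\<close> attains the value \<open>p x0\<close>.
\<close>

lemma Hahn_Banach_sublinear:
  fixes p :: "'a::real_vector \<Rightarrow> real"
  assumes p: "sublinear p"
  obtains u where "linear u" "\<And>x. u x \<le> p x" "u x0 = p x0"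
proof -
  obtain p' where p': "sublinear p'" "\<And>x. p' x \<le> p x" "\<And>x. p' x \<le> p (x + x0) - p x0"
    using sublinear_lower[OF p] by metis
  obtain u where u: "sublinear u" "\<And>x. u x \<le> p' x"
    and min: "\<And>r. sublinear r \<Longrightarrow> (\<And>x. r x \<le> u x) \<Longrightarrow> r = u"
    using minimal_sublinear[OF p'(1)] by metis
  have add: "u (x + y) = u x + u y" for x y
  proof -
    obtain r where r: "sublinear r" "\<And>x. r x \<le> u x" "\<And>x. r x \<le> u (x + y) - u y"
      using sublinear_lower[OF u(1)] by metis
    have "r = u" using r min by blast
    then have "u x + u y \<le> u (x + y)" using r(3)[of x] by simp
    then show ?thesis using sublinear_add[OF u(1), of x y] by simp
  qed
  have neg: "u (- x) = - u x" for x
    using add[of x "- x"] sublinear_0[OF u(1)] by simp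
  have "linear u"
  proof (rule linearI)
    show "u (x + y) = u x + u y" for x y by (rule add)
    fix c :: real and x
    show "u (c *\<^sub>R x) = c *\<^sub>R u x"
    proof (cases "0 \<le> c")
      case False
      then show ?thesis using sublinear_scale[OF u(1), of "- c" x] neg[of "c *\<^sub>R x"] by simp
    qed (simp add: sublinear_scale[OF u(1)])
  qed
  moreover have "u x \<le> p x" for x using u(2) p'(2) order_trans by blast
  moreover have "u x0 = p x0"
  proof -
    have "- u x0 \<le> - p x0"
      using u(2)[of "- x0"] p'(3)[of "- x0"] neg[of x0] sublinear_0[OF p] by simp
    then show ?thesis using \<open>u x0 \<le> p x0\<close> by simp
  qed
  ultimately show thesis using that by blast
qed

text \<open>
  The real functional \<open>u\<close> given by the norm is the real part of the complex functional
  \<open>x \<mapsto> u x - i u (i x)\<close>. The bound passes to the modulus because \<open>\<phi> x\<close> can be rotated onto the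
  positive real axis.
\<close>

lemma norming_functional:
  fixes x0 :: "'a::complex_normed_vector"
  obtains \<phi> :: "'a \<Rightarrow> complex" where "bounded_linear \<phi>" "\<And>c x. \<phi> (c *\<^sub>C x) = c * \<phi> x"
    "\<And>x. cmod (\<phi> x) \<le> norm x" "\<phi> x0 = of_real (norm x0)"
proof -
  have "sublinear (norm :: 'a \<Rightarrow> real)" by (simp add: sublinear_def norm_triangle_ineq)
  then obtain u :: "'a \<Rightarrow> real" where u: "linear u" "\<And>x. u x \<le> norm x" "u x0 = norm x0"
    using Hahn_Banach_sublinear by metis
  interpret u: linear u by (rule u(1))
  define \<phi> where "\<phi> x = Complex (u x) (- u (\<i> *\<^sub>C x))" for x
  have [simp]: "1 *\<^sub>C x = x" for x :: 'a using scaleC_of_real[of 1 x] by simp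
  have CR: "c *\<^sub>C x = Re c *\<^sub>R x + Im c *\<^sub>R (\<i> *\<^sub>C x)" for c and x :: 'a
  proof -
    have "c *\<^sub>C x = (of_real (Re c) + of_real (Im c) * \<i>) *\<^sub>C x"
      using complex_eq[of c] by (simp add: mult.commute)
    then show ?thesis by (simp add: scaleC_add_left scaleC_of_real flip: scaleC_scaleC)
  qed
  have ii: "\<i> *\<^sub>C \<i> *\<^sub>C x = - x" for x :: 'a
    using scaleC_of_real[of "-1" x] by (simp add: scaleC_scaleC)
  have comm: "c *\<^sub>C (r *\<^sub>R x) = r *\<^sub>R (c *\<^sub>C x)" for c r and x :: 'a
    by (simp add: scaleC_scaleC mult.commute flip: scaleC_of_real)
  have scale: "\<phi> (c *\<^sub>C x) = c * \<phi> x" for c x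
    unfolding \<phi>_def CR[of c]
    by (simp add: scaleC_add_right comm ii complex_eq_iff u.add u.diff u.scale u.neg algebra_simps)
  have "linear \<phi>"
  proof (rule linearI)
    show "\<phi> (x + y) = \<phi> x + \<phi> y" for x y
      by (simp add: \<phi>_def scaleC_add_right u.add complex_eq_iff)
    show "\<phi> (r *\<^sub>R x) = r *\<^sub>R \<phi> x" for r x
      using scale[of "of_real r" x] by (simp add: scaleC_of_real scaleR_conv_of_real)
  qed
  have bound: "cmod (\<phi> x) \<le> norm x" for x
  proof (cases "\<phi> x = 0")
    case False
    define c where "c = cnj (\<phi> x) / cmod (\<phi> x)"
    have "cmod c = 1" using False by (simp add: c_def norm_divide)
    have "\<phi> (c *\<^sub>C x) = of_real (cmod (\<phi> x))"
      using False unfolding scale c_def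
      by (simp add: field_simps complex_norm_square[symmetric] power2_eq_square)
    then have "cmod (\<phi> x) = u (c *\<^sub>C x)" by (metis \<phi>_def complex.sel(1) Re_complex_of_real)
    also have "\<dots> \<le> norm x" using u(2)[of "c *\<^sub>C x"] \<open>cmod c = 1\<close> by (simp add: norm_scaleC)
    finally show ?thesis .
  qed simp
  show thesis
  proof
    show "bounded_linear \<phi>"
      using \<open>linear \<phi>\<close> bound
      by (intro bounded_linear.intro bounded_linear_axioms.intro exI[of _ 1]) simp_all
    have "(norm x0)\<^sup>2 + (Im (\<phi> x0))\<^sup>2 \<le> (norm x0)\<^sup>2"
      using power_mono[OF bound[of x0], of 2] by (simp add: cmod_power2 \<phi>_def u(3))
    then have "Im (\<phi> x0) = 0" by simp
    then show "\<phi> x0 = of_real (norm x0)" by (simp add: complex_eq_iff \<phi>_def u(3))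
  qed (use scale bound in simp_all)
qed

section \<open>A bounded holomorphic series of bumps in the right half-plane\<close>

text \<open>
  On the half-plane \<open>Re w > 0\<close> this rational function is concentrated at the scale \<open>\<bar>w\<bar> = t\<close>: it
  equals \<open>1\<close> at \<open>w = t\<close> and is at most of order \<open>min (t/\<bar>w\<bar>) (\<bar>w\<bar>/t)\<close> elsewhere.
\<close>

definition bump :: "real \<Rightarrow> complex \<Rightarrow> complex" where
  "bump t w = 4 * of_real t * w / (of_real t + w)\<^sup>2"

lemma bump_of_real: "bump t (of_real r) = of_real (4 * t * r / (t + r)\<^sup>2)"
  by (simp add: bump_def)

lemma bump_same: "t > 0 \<Longrightarrow> bump t (of_real t) = 1"
  by (simp add: bump_def power2_eq_square field_simps)

text \<open>
  For \<open>Re w > 0\<close> the pole at \<open>- t\<close> is far away: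
  \<open>\<bar>t + w\<bar>\<^sup>2 \<ge> t\<^sup>2 + \<bar>w\<bar>\<^sup>2 \<ge> (t + \<bar>w\<bar>)\<^sup>2 / 2\<close>.
\<close>

lemma cmod_bump_le:
  assumes "t > 0" "Re w > 0"
  shows "cmod (bump t w) \<le> 8 * (t * cmod w / (t + cmod w)\<^sup>2)"
proof -
  have "w \<noteq> 0" using assms by auto
  have "(cmod (of_real t + w))\<^sup>2 = t\<^sup>2 + (cmod w)\<^sup>2 + 2 * t * Re w"
    unfolding cmod_power2 by (simp add: power2_eq_square algebra_simps)
  moreover have "0 \<le> 2 * t * Re w" "0 \<le> (t - cmod w)\<^sup>2" using assms by auto
  ultimately have "(t + cmod w)\<^sup>2 / 2 \<le> (cmod (of_real t + w))\<^sup>2"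
    by (simp add: power2_eq_square algebra_simps)
  moreover have "0 < (t + cmod w)\<^sup>2 / 2"
    using add_pos_nonneg[OF assms(1) norm_ge_zero[of w]] by simp
  ultimately have "4 * t * cmod w / (cmod (of_real t + w))\<^sup>2 \<le> 4 * t * cmod w / ((t + cmod w)\<^sup>2 / 2)"
    using assms by (intro divide_left_mono mult_nonneg_nonneg mult_pos_pos) auto
  then show ?thesis
    using assms by (simp add: bump_def norm_divide norm_mult norm_power)
qed

lemma cmod_bump_le_far:
  assumes "t > 0" "Re w > 0"
  shows "cmod (bump t w) \<le> 8 * t / cmod w"
proof -
  have "w \<noteq> 0" using assms by auto
  then have "0 < cmod w" "0 < t + cmod w" using assms by (simp_all add: add_pos_nonneg)
  then have "t * cmod w / (t + cmod w)\<^sup>2 \<le> t * cmod w / (cmod w)\<^sup>2"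
    using assms by (intro divide_left_mono power_mono mult_pos_pos zero_less_power) auto
  also have "\<dots> = t / cmod w" using \<open>w \<noteq> 0\<close> by (simp add: power2_eq_square)
  finally show ?thesis using cmod_bump_le[OF assms] by simp
qed

text \<open>
  With \<open>G u = u / (u + r)\<close>, each term is at most \<open>2 (G (t n) - G (t n / 2))\<close>. Since \<open>G\<close> is
  increasing and \<open>t (Suc n) \<le> t n / 2\<close>, these differences telescope. The bound gives uniform
  boundedness of the whole series, as \<open>0 \<le> G \<le> 1\<close>, and also smallness of its parts on either side
  of a fixed scale.
\<close>

lemma sum_bump_le:
  fixes t :: "nat \<Rightarrow> real"
  assumes r: "r > 0" and t: "\<And>n. t n > 0" "\<And>n. t (Suc n) \<le> t n / 2" and "i \<le> j"
  shows "(\<Sum>n=i..j. t n * r / (t n + r)\<^sup>2) \<le> 2 * (t i / (t i + r) - (t j / 2) / (t j / 2 + r))"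
  using \<open>i \<le> j\<close>
proof (induction j rule: nat_induct_at_least)
  have step: "t n * r / (t n + r)\<^sup>2 \<le> 2 * (t n / (t n + r) - (t n / 2) / (t n / 2 + r))" for n
  proof -
    have "t n * r / (t n + r)\<^sup>2 \<le> t n * r / ((t n + r) * (t n / 2 + r))"
      using t(1)[of n] r by (intro divide_left_mono) (auto simp: power2_eq_square)
    also have "\<dots> = 2 * (t n / (t n + r) - (t n / 2) / (t n / 2 + r))"
      using t(1)[of n] r by (simp add: divide_simps add_nonneg_eq_0_iff) (simp add: algebra_simps)
    finally show ?thesis .
  qed
  { case base
    show ?case using step[of i] by simp
  next
    case (Suc j)
    have "t (Suc j) / (t (Suc j) + r) \<le> (t j / 2) / (t j / 2 + r)"
      using t(1)[of "Suc j"] t(1)[of j] t(2)[of j] r by (simp add: divide_simps) (simp add: algebra_simps)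
    then show ?case using Suc step[of "Suc j"] by simp }
qed

text \<open>
  The scales have to decrease faster than geometrically: as the ratio of consecutive scales tends to
  \<open>0\<close>, the bumps interfere less and less with each other.
\<close>

definition knot :: "nat \<Rightarrow> real" where
  "knot n = 1 / fact (Suc n)"

lemma knot_pos: "knot n > 0" and knot_le_1: "knot n \<le> 1"
  by (simp_all add: knot_def field_simps del: fact_Suc)

lemma knot_Suc: "knot (Suc n) = knot n / real (n + 2)"
  unfolding knot_def by (subst (2) fact_Suc) (simp add: field_simps)

lemma knot_Suc_le: "knot (Suc n) \<le> knot n / 2"
  unfolding knot_Suc using knot_pos[of n] by (intro divide_left_mono) auto

lemma summable_knot: "summable knot"
proof -
  have "summable (\<lambda>n. inverse (fact n) :: real)" using summable_exp[of "1::real"] by simp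
  then show ?thesis unfolding knot_def by (subst (asm) summable_Suc_iff[symmetric]) (simp add: field_simps del: fact_Suc)
qed

lemma knot_tendsto_0: "knot \<longlonglongrightarrow> 0"
  by (rule summable_LIMSEQ_zero[OF summable_knot])

text \<open>
  For bounded coefficients this is a bounded holomorphic function on the right half-plane that nearly
  interpolates the coefficient \<open>a m\<close> at the point \<open>knot m\<close>.
\<close>

definition bump_series :: "(nat \<Rightarrow> complex) \<Rightarrow> complex \<Rightarrow> complex" where
  "bump_series a w = (\<Sum>n. a n * bump (knot n) w)"

lemma
  assumes a: "\<And>n. cmod (a n) \<le> A" and w: "Re w > 0"
  shows summable_bump: "summable (\<lambda>n. cmod (a n * bump (knot n) w))"
    and cmod_bump_series_le: "cmod (bump_series a w) \<le> 16 * A"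
proof -
  have "0 \<le> A" using a[of 0] norm_ge_zero order_trans by blast
  define r where "r = cmod w"
  have r: "r > 0" using w by (auto simp: r_def)
  have part: "(\<Sum>n<N. cmod (a n * bump (knot n) w)) \<le> 16 * A" for N
  proof (cases N)
    case (Suc M)
    have "(\<Sum>n<N. cmod (a n * bump (knot n) w)) \<le> (\<Sum>n<N. A * (8 * (knot n * r / (knot n + r)\<^sup>2)))"
      unfolding norm_mult r_def using a w \<open>0 \<le> A\<close>
      by (intro sum_mono mult_mono cmod_bump_le knot_pos) auto
    also have "\<dots> = 8 * A * (\<Sum>n=0..M. knot n * r / (knot n + r)\<^sup>2)"
      unfolding Suc sum_distrib_left by (intro sum.cong) (auto simp: mult_ac)
    also have "\<dots> \<le> 8 * A * (2 * (knot 0 / (knot 0 + r) - (knot M / 2) / (knot M / 2 + r)))"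
      using \<open>0 \<le> A\<close> by (intro mult_left_mono sum_bump_le r knot_pos knot_Suc_le) auto
    also have "\<dots> \<le> 8 * A * (2 * (1 - 0))"
      using knot_pos[of 0] knot_pos[of M] r \<open>0 \<le> A\<close>
      by (intro mult_left_mono diff_mono) (auto simp: field_simps)
    finally show ?thesis by simp
  qed (use \<open>0 \<le> A\<close> in simp)
  show *: "summable (\<lambda>n. cmod (a n * bump (knot n) w))"
    by (rule summableI_nonneg_bounded[OF _ part]) simp
  have "cmod (bump_series a w) \<le> (\<Sum>n. cmod (a n * bump (knot n) w))"
    unfolding bump_series_def by (rule summable_norm[OF *])
  also have "\<dots> \<le> 16 * A" by (rule suminf_le_const[OF * part])
  finally show "cmod (bump_series a w) \<le> 16 * A" .
qed

text \<open>
  Near a point \<open>w\<close> of the half-plane the arguments stay away from \<open>0\<close>, so the terms are dominated by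
  a multiple of the summable sequence \<open>knot\<close>.
\<close>

lemma bump_series_holomorphic:
  assumes a: "\<And>n. cmod (a n) \<le> A"
  shows "bump_series a holomorphic_on {w. Re w > 0}"
proof -
  let ?S = "{w::complex. Re w > 0}"
  have "0 \<le> A" using a[of 0] norm_ge_zero order_trans by blast
  have S: "open ?S" by (rule open_halfspace_Re_gt)
  obtain g where g: "\<forall>w\<in>?S. (\<lambda>n. a n * bump (knot n) w) sums g w \<and> g field_differentiable (at w)"
  proof (rule series_differentiable_comparison_complex[OF S])
    fix n and w :: complex assume w: "w \<in> ?S"
    have "of_real (knot n) + w \<noteq> 0" using w knot_pos[of n] by (auto simp: complex_eq_iff)
    then show "(\<lambda>w. a n * bump (knot n) w) field_differentiable (at w)"
      unfolding bump_def by (intro derivative_intros) auto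
  next
    fix w :: complex assume w: "w \<in> ?S"
    then have w0: "0 < cmod w" by auto
    define h :: "nat \<Rightarrow> complex" where "h n = of_real (16 * A / cmod w * knot n)" for n
    have hpos: "0 \<le> 16 * A / cmod w * knot n" for n
      using \<open>0 \<le> A\<close> w0 knot_pos[of n] by simp
    have "cmod (a n * bump (knot n) y) \<le> cmod (h n)" if y: "y \<in> ball w (cmod w / 2) \<inter> ?S" for n y
    proof -
      have yn: "cmod w / 2 \<le> cmod y" 
        using y norm_triangle_ineq2[of w y] by (simp add: dist_norm)
      have "cmod (bump (knot n) y) \<le> 8 * knot n / cmod y"
        using y by (intro cmod_bump_le_far knot_pos) auto
      also have "\<dots> \<le> 8 * knot n / (cmod w / 2)"
        using yn w0 knot_pos[of n] by (intro divide_left_mono mult_pos_pos) linarith+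
      finally have "cmod (a n * bump (knot n) y) \<le> A * (8 * knot n / (cmod w / 2))"
        unfolding norm_mult using a \<open>0 \<le> A\<close> by (intro mult_mono) auto
      then show ?thesis
        unfolding h_def norm_of_real abs_of_nonneg[OF hpos] by (simp add: mult_ac)
    qed
    moreover have "summable h"
      unfolding h_def summable_of_real_iff by (intro summable_mult summable_knot)
    moreover have "range h \<subseteq> \<real>\<^sub>\<ge>\<^sub>0"
      unfolding h_def using hpos by (auto simp del: of_real_mult of_real_divide)
    ultimately show "\<exists>d h. 0 < d \<and> summable h \<and> range h \<subseteq> \<real>\<^sub>\<ge>\<^sub>0 \<and>
        (\<forall>\<^sub>F n in sequentially. \<forall>y\<in>ball w d \<inter> ?S. cmod (a n * bump (knot n) y) \<le> cmod (h n))"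
      using w0 by (intro exI[of _ "cmod w / 2"] exI[of _ h]) auto
  qed
  then have "g holomorphic_on ?S"
    by (auto simp: holomorphic_on_def intro: field_differentiable_at_within)
  then show ?thesis
    by (rule holomorphic_transform) (use g in \<open>auto simp: bump_series_def sums_iff\<close>)
qed

text \<open>
  At \<open>knot m\<close> the \<open>m\<close>-th bump is \<open>1\<close>. The bumps of larger scale contribute at most a multiple of
  \<open>knot m / knot (m - 1)\<close> and those of smaller scale at most a multiple of
  \<open>knot (Suc m) / knot m\<close>, and both ratios are of order \<open>1 / m\<close>.
\<close>

lemma bump_series_at_knot:
  assumes a: "\<And>n. cmod (a n) \<le> A"
  shows "cmod (bump_series a (of_real (knot m)) - a m) \<le> 24 * A / real (m + 1)"
proof -
  have "0 \<le> A" using a[of 0] norm_ge_zero order_trans by blast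
  define r where "r = knot m"
  have r: "r > 0" by (simp add: r_def knot_pos)
  define c where "c n = knot n * r / (knot n + r)\<^sup>2" for n
  define f where "f n = a n * bump (knot n) (of_real r)" for n
  have cpos: "0 \<le> c n" for n using knot_pos[of n] r by (simp add: c_def)
  have fle: "cmod (f n) \<le> 4 * A * c n" for n
  proof -
    have "cmod (f n) = cmod (a n) * (4 * c n)"
      using r knot_pos[of n] unfolding f_def bump_of_real norm_mult norm_of_real
      by (simp add: c_def abs_mult)
    also have "\<dots> \<le> A * (4 * c n)" using a cpos[of n] by (intro mult_right_mono) auto
    finally show ?thesis by simp
  qed
  have below: "(\<Sum>n<m. c n) \<le> 4 / real (m + 1)"
  proof (cases m)
    case (Suc k)
    have kr: "r = knot k / real (k + 2)" by (simp add: r_def Suc knot_Suc)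
    have "(\<Sum>n<m. c n) = (\<Sum>n=0..k. c n)" unfolding Suc by (intro sum.cong) auto
    also have "\<dots> \<le> 2 * (knot 0 / (knot 0 + r) - (knot k / 2) / (knot k / 2 + r))"
      unfolding c_def by (intro sum_bump_le r knot_pos knot_Suc_le) auto
    also have "\<dots> \<le> 2 * (1 - (knot k / 2) / (knot k / 2 + r))"
      using knot_pos[of 0] r by (intro mult_left_mono diff_mono) auto
    also have "\<dots> = 2 * r / (knot k / 2 + r)"
      using knot_pos[of k] r by (simp add: field_simps)
    also have "\<dots> \<le> 2 * r / (knot k / 2)"
      using knot_pos[of k] r by (intro divide_left_mono) auto
    also have "\<dots> = 4 / real (m + 1)"
      using knot_pos[of k] by (simp add: kr Suc)
    finally show ?thesis .
  qed simp
  have above: "(\<Sum>n=Suc m..<N. c n) \<le> 2 / real (m + 1)" for N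
  proof (cases "Suc m < N")
    case True
    then obtain M where N: "N = Suc M" "Suc m \<le> M" by (cases N) auto
    have "(\<Sum>n=Suc m..<N. c n) = (\<Sum>n=Suc m..M. c n)" unfolding N by (intro sum.cong) auto
    also have "\<dots> \<le> 2 * (knot (Suc m) / (knot (Suc m) + r) - (knot M / 2) / (knot M / 2 + r))"
      unfolding c_def by (intro sum_bump_le r knot_pos knot_Suc_le N)
    also have "\<dots> \<le> 2 * (knot (Suc m) / r - 0)"
      using knot_pos[of "Suc m"] knot_pos[of M] r
      by (intro mult_left_mono diff_mono divide_left_mono) auto
    also have "\<dots> = 2 / real (m + 2)" using r by (simp add: knot_Suc r_def)
    also have "\<dots> \<le> 2 / real (m + 1)" by (intro divide_left_mono) auto
    finally show ?thesis .
  qed simp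
  have S: "summable (\<lambda>n. cmod (f n))"
    unfolding f_def using r by (intro summable_bump[OF a]) simp
  have "(\<lambda>N. \<Sum>n<N. f n) \<longlonglongrightarrow> bump_series a (of_real r)"
    unfolding bump_series_def f_def[symmetric]
    by (rule summable_LIMSEQ[OF summable_norm_cancel[OF S]])
  then have lim: "(\<lambda>N. cmod ((\<Sum>n<N. f n) - a m)) \<longlonglongrightarrow> cmod (bump_series a (of_real r) - a m)"
    by (intro tendsto_intros)
  have "cmod ((\<Sum>n<N. f n) - a m) \<le> 24 * A / real (m + 1)" if N: "m < N" for N
  proof -
    have "(\<Sum>n<N. f n) = (\<Sum>n<m. f n) + f m + (\<Sum>n=Suc m..<N. f n)"
      using N sum.atLeastLessThan_concat[of 0 m N f] sum.atLeast_Suc_lessThan[OF N, of f]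
      by (simp add: lessThan_atLeast0 add.assoc)
    also have "f m = a m" by (simp add: f_def r_def bump_same knot_pos)
    finally have "cmod ((\<Sum>n<N. f n) - a m) = cmod ((\<Sum>n<m. f n) + (\<Sum>n=Suc m..<N. f n))"
      by simp
    also have "\<dots> \<le> (\<Sum>n<m. 4 * A * c n) + (\<Sum>n=Suc m..<N. 4 * A * c n)"
      using fle by (intro norm_triangle_le add_mono sum_norm_le) auto
    also have "\<dots> = 4 * A * ((\<Sum>n<m. c n) + (\<Sum>n=Suc m..<N. c n))"
      by (simp add: sum_distrib_left distrib_left)
    also have "\<dots> \<le> 4 * A * (4 / real (m + 1) + 2 / real (m + 1))"
      using \<open>0 \<le> A\<close> below above by (intro mult_left_mono add_mono) auto
    also have "\<dots> = 24 * A / real (m + 1)" by (simp flip: add_divide_distrib)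
    finally show ?thesis .
  qed
  then have "\<forall>\<^sub>F N in sequentially. cmod ((\<Sum>n<N. f n) - a m) \<le> 24 * A / real (m + 1)"
    by (auto simp: eventually_sequentially intro!: exI[of _ "Suc m"])
  then show ?thesis
    using tendsto_upperbound[OF lim] by (simp add: r_def)
qed

section \<open>Bounded holomorphic functions that are not Lipschitz\<close>

text \<open>
  Every entry of \<open>s\<close> is repeated infinitely often, and so is the extra value \<open>0\<close>. As coefficients of
  a bump series at points that tend to \<open>0\<close>, these values all become cluster values of the series
  at \<open>0\<close>; the value \<open>0\<close> is there so that a limit at \<open>0\<close> can only be \<open>0\<close>.
\<close>

definition repeat_each :: "(nat \<Rightarrow> complex) \<Rightarrow> nat \<Rightarrow> complex" where
  "repeat_each s n = (case fst (prod_decode n) of 0 \<Rightarrow> 0 | Suc k \<Rightarrow> s k)"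

lemma repeat_each_add: "repeat_each (s + t) n = repeat_each s n + repeat_each t n"
  and repeat_each_mult: "repeat_each (\<lambda>i. c * s i) n = c * repeat_each s n"
  by (simp_all add: repeat_each_def split: nat.split)

lemma cmod_le_linf_norm: "s \<in> linf \<Longrightarrow> cmod (s n) \<le> linf_norm s"
  unfolding linf_norm_def linf_def by (intro cSUP_upper bdd_above_cmod) auto

lemma linf_norm_le: "(\<And>n. cmod (s n) \<le> C) \<Longrightarrow> linf_norm s \<le> C"
  unfolding linf_norm_def by (intro cSUP_least) auto

lemma linf_norm_nonneg: "s \<in> linf \<Longrightarrow> 0 \<le> linf_norm s"
  by (rule fun_norm.norm_nonneg[OF fun_norm_linf])

lemma cmod_repeat_each_le: "s \<in> linf \<Longrightarrow> cmod (repeat_each s n) \<le> linf_norm s"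
  by (auto simp: repeat_each_def cmod_le_linf_norm linf_norm_nonneg split: nat.split)

lemma cmod_le_sup_norm: "f \<in> Hinf0 \<Longrightarrow> x \<in> ball 0 1 \<Longrightarrow> cmod (f x) \<le> sup_norm f"
  unfolding sup_norm_def Hinf0_def by (intro cSUP_upper bdd_above_cmod) auto

lemma frechet_holomorphic_on_compose:
  fixes \<phi> :: "'a::complex_normed_vector \<Rightarrow> complex"
  assumes \<phi>: "bounded_linear \<phi>" "\<And>c x. \<phi> (c *\<^sub>C x) = c * \<phi> x"
    and g: "g holomorphic_on S" "open S" and im: "\<phi> ` U \<subseteq> S"
  shows "frechet_holomorphic_on (\<lambda>x. g (\<phi> x)) U"
  unfolding frechet_holomorphic_on_def
proof
  fix x assume "x \<in> U"
  then have "(g has_field_derivative deriv g (\<phi> x)) (at (\<phi> x))"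
    using g im by (intro holomorphic_derivI) auto
  then have "((\<lambda>x. g (\<phi> x)) has_derivative (\<lambda>v. deriv g (\<phi> x) * \<phi> v)) (at x)"
    using has_derivative_compose[OF bounded_linear_imp_has_derivative[OF \<phi>(1)]]
    by (simp add: has_field_derivative_def)
  then show "\<exists>D. ((\<lambda>x. g (\<phi> x)) has_derivative D) (at x) \<and> (\<forall>c v. D (c *\<^sub>C v) = c * D v)"
    using \<phi>(2) by (intro exI[of _ "\<lambda>v. deriv g (\<phi> x) * \<phi> v"]) auto
qed

text \<open>
  The substitution \<open>w = 1 - \<phi> x\<close> maps the unit ball into the right half-plane. The factor \<open>\<phi> x\<close>
  makes the function vanish at the origin and tends to \<open>1\<close> where the cluster values are taken.
\<close>

definition bump_fun :: "('a \<Rightarrow> complex) \<Rightarrow> (nat \<Rightarrow> complex) \<Rightarrow> 'a::complex_normed_vector \<Rightarrow> complex" where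
  "bump_fun \<phi> s x =
     (if x \<in> ball 0 1 then \<phi> x * bump_series (repeat_each s) (1 - \<phi> x) else 0)"

locale norming =
  fixes \<phi> :: "'a::complex_normed_vector \<Rightarrow> complex" and x0 :: 'a
  assumes linear: "bounded_linear \<phi>" and scaleC: "\<phi> (c *\<^sub>C x) = c * \<phi> x"
    and le_norm: "cmod (\<phi> x) \<le> norm x"
    and norm_x0: "norm x0 = 1" and at_x0: "\<phi> x0 = 1"
begin

lemma Re_pos:
  assumes "x \<in> ball 0 1"
  shows "Re (1 - \<phi> x) > 0"
  using assms le_norm[of x] complex_Re_le_cmod[of "\<phi> x"] by simp

lemma bump_fun_add:
  assumes "s \<in> linf" "t \<in> linf"
  shows "bump_fun \<phi> (s + t) = bump_fun \<phi> s + bump_fun \<phi> t"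
proof
  fix x
  show "bump_fun \<phi> (s + t) x = (bump_fun \<phi> s + bump_fun \<phi> t) x"
  proof (cases "x \<in> ball 0 1")
    case True
    have S: "summable (\<lambda>n. repeat_each u n * bump (knot n) (1 - \<phi> x))" if "u \<in> linf" for u
      by (rule summable_norm_cancel[OF summable_bump[OF cmod_repeat_each_le[OF that] Re_pos[OF True]]])
    show ?thesis
      using True suminf_add[OF S[OF assms(1)] S[OF assms(2)]]
      by (simp add: bump_fun_def bump_series_def repeat_each_add distrib_right flip: distrib_left)
  qed (simp add: bump_fun_def)
qed

lemma bump_fun_mult:
  assumes "s \<in> linf"
  shows "bump_fun \<phi> (\<lambda>i. c * s i) = (\<lambda>x. c * bump_fun \<phi> s x)"
proof
  fix x
  show "bump_fun \<phi> (\<lambda>i. c * s i) x = c * bump_fun \<phi> s x"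
  proof (cases "x \<in> ball 0 1")
    case True
    note S = summable_norm_cancel[OF summable_bump[OF cmod_repeat_each_le[OF assms] Re_pos[OF True]]]
    show ?thesis
      using True suminf_mult[OF S, of c]
      by (simp add: bump_fun_def bump_series_def repeat_each_mult mult_ac)
  qed (simp add: bump_fun_def)
qed

lemma cmod_bump_fun_le:
  assumes "s \<in> linf"
  shows "cmod (bump_fun \<phi> s x) \<le> 16 * linf_norm s"
proof (cases "x \<in> ball 0 1")
  case True
  have "cmod (bump_series (repeat_each s) (1 - \<phi> x)) \<le> 16 * linf_norm s"
    by (intro cmod_bump_series_le cmod_repeat_each_le assms Re_pos True)
  moreover have "cmod (\<phi> x) \<le> 1" using le_norm[of x] True by simp
  ultimately have "cmod (\<phi> x) * cmod (bump_series (repeat_each s) (1 - \<phi> x)) \<le> 1 * (16 * linf_norm s)"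
    by (intro mult_mono) auto
  then show ?thesis using True by (simp add: bump_fun_def norm_mult)
qed (simp add: bump_fun_def linf_norm_nonneg assms)

lemma bump_fun_Hinf0:
  assumes "s \<in> linf"
  shows "bump_fun \<phi> s \<in> Hinf0"
proof -
  define g where "g z = z * bump_series (repeat_each s) (1 - z)" for z
  have S: "open {z::complex. Re z < 1}" by (rule open_halfspace_Re_lt)
  have "bump_series (repeat_each s) holomorphic_on {w. Re w > 0}"
    by (rule bump_series_holomorphic[OF cmod_repeat_each_le[OF assms]])
  then have "(bump_series (repeat_each s) \<circ> (\<lambda>z. 1 - z)) holomorphic_on {z. Re z < 1}"
    by (intro holomorphic_on_compose_gen[where t="{w. Re w > 0}"] holomorphic_intros) auto
  then have g: "g holomorphic_on {z. Re z < 1}"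
    unfolding g_def o_def by (intro holomorphic_intros)
  have "frechet_holomorphic_on (\<lambda>x. g (\<phi> x)) (ball 0 1)"
    using Re_pos by (intro frechet_holomorphic_on_compose[OF linear scaleC g S]) auto
  then have "frechet_holomorphic_on (bump_fun \<phi> s) (ball 0 1)"
    unfolding frechet_holomorphic_on_def
    by (metis (no_types, lifting) has_derivative_transform_within_open open_ball bump_fun_def g_def)
  moreover have "bounded (bump_fun \<phi> s ` ball 0 1)"
    using cmod_bump_fun_le[OF assms] by (auto simp: bounded_iff)
  moreover have "\<phi> 0 = 0" using bounded_linear.linear[OF linear] by (rule linear_0)
  ultimately show ?thesis by (simp add: Hinf0_def ball_fun_def bump_fun_def)
qed

text \<open>
  A sequence in the ball that tends to \<open>x0\<close> and along which only coefficients of the \<open>i\<close>-th kind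
  are interpolated.
\<close>

definition approach :: "nat \<Rightarrow> nat \<Rightarrow> 'a" where
  "approach i j = (1 - knot (prod_encode (i, j))) *\<^sub>R x0"

lemma approach_ball: "approach i j \<in> ball 0 1"
  using knot_pos knot_le_1 by (simp add: approach_def norm_x0)

lemma filterlim_prod_encode: "filterlim (\<lambda>j. prod_encode (i, j)) sequentially sequentially"
  by (rule filterlim_at_top_mono[OF filterlim_ident]) (simp add: le_prod_encode_2)

lemma knot_prod_encode: "(\<lambda>j. knot (prod_encode (i, j))) \<longlonglongrightarrow> 0"
  by (rule filterlim_compose[OF knot_tendsto_0 filterlim_prod_encode])

lemma bump_fun_approach:
  assumes s: "s \<in> linf"
  shows "(\<lambda>j. bump_fun \<phi> s (approach i j)) \<longlonglongrightarrow> (case i of 0 \<Rightarrow> 0 | Suc k \<Rightarrow> s k)"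
proof -
  define m where "m j = prod_encode (i, j)" for j
  define b where "b j = bump_series (repeat_each s) (of_real (knot (m j)))" for j
  define l where "l = (case i of 0 \<Rightarrow> 0 | Suc k \<Rightarrow> s k)"
  have \<phi>: "\<phi> (approach i j) = of_real (1 - knot (m j))" for j
    using linear_scale[OF bounded_linear.linear[OF linear]]
    by (simp add: approach_def m_def at_x0 scaleR_conv_of_real)
  have l: "repeat_each s (m j) = l" for j by (simp add: repeat_each_def m_def l_def)
  have "cmod (b j - l) \<le> 24 * linf_norm s / real (m j + 1)" for j
    using bump_series_at_knot[of "repeat_each s" "linf_norm s" "m j"] cmod_repeat_each_le[OF s] by (simp add: b_def l)
  moreover have "(\<lambda>j. 24 * linf_norm s / real (m j + 1)) \<longlonglongrightarrow> 0"
  proof -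
    have "(\<lambda>n. 24 * linf_norm s / real (n + 1)) \<longlonglongrightarrow> 0"
      using LIMSEQ_Suc[OF lim_const_over_n[of "24 * linf_norm s"]] by simp
    then show ?thesis unfolding m_def by (rule filterlim_compose[OF _ filterlim_prod_encode])
  qed
  ultimately have "(\<lambda>j. b j - l) \<longlonglongrightarrow> 0"
    by (intro Lim_null_comparison[of "\<lambda>j. b j - l"]) auto
  then have "b \<longlonglongrightarrow> l" by (simp add: LIM_zero_iff)
  then have "(\<lambda>j. of_real (1 - knot (m j)) * b j) \<longlonglongrightarrow> of_real (1 - 0) * l"
    unfolding m_def by (intro tendsto_intros knot_prod_encode)
  moreover have "bump_fun \<phi> s (approach i j) = of_real (1 - knot (m j)) * b j" for j
    using approach_ball[of i j] by (simp add: bump_fun_def \<phi> b_def)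
  ultimately show ?thesis by (simp add: l_def)
qed

lemma linf_norm_le_bump_fun:
  assumes s: "s \<in> linf"
  shows "linf_norm s \<le> sup_norm (bump_fun \<phi> s)"
proof (rule linf_norm_le)
  fix k
  have "(\<lambda>j. cmod (bump_fun \<phi> s (approach (Suc k) j))) \<longlonglongrightarrow> cmod (s k)"
    using tendsto_norm[OF bump_fun_approach[OF s, of "Suc k"]] by simp
  then show "cmod (s k) \<le> sup_norm (bump_fun \<phi> s)"
    by (rule tendsto_upperbound)
       (auto intro!: always_eventually cmod_le_sup_norm bump_fun_Hinf0 s approach_ball)
qed

text \<open>
  A Lipschitz function has the same limit along all sequences that tend to \<open>x0\<close>, but along
  \<open>approach (Suc k)\<close> the limit is \<open>s k\<close> and along \<open>approach 0\<close> it is \<open>0\<close>.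
\<close>

lemma bump_fun_not_Lipschitz:
  assumes s: "s \<in> linf" and L: "L-lipschitz_on (ball 0 1) (bump_fun \<phi> s)"
  shows "s = 0"
proof
  fix k
  let ?f = "bump_fun \<phi> s"
  have "norm (approach (Suc k) j - approach 0 j)
      = \<bar>knot (prod_encode (0, j)) - knot (prod_encode (Suc k, j))\<bar>" for j
    by (simp add: approach_def norm_x0 flip: scaleR_left_diff_distrib)
  then have le: "cmod (?f (approach (Suc k) j) - ?f (approach 0 j))
      \<le> L * \<bar>knot (prod_encode (0, j)) - knot (prod_encode (Suc k, j))\<bar>" for j
    using lipschitz_onD[OF L approach_ball approach_ball, of "Suc k" j 0 j] by (simp add: dist_norm)
  have "(\<lambda>j. L * \<bar>knot (prod_encode (0, j)) - knot (prod_encode (Suc k, j))\<bar>) \<longlonglongrightarrow> L * \<bar>0 - 0\<bar>"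
    by (intro tendsto_intros knot_prod_encode)
  then have "(\<lambda>j. L * \<bar>knot (prod_encode (0, j)) - knot (prod_encode (Suc k, j))\<bar>) \<longlonglongrightarrow> 0"
    by simp
  then have "(\<lambda>j. ?f (approach (Suc k) j) - ?f (approach 0 j)) \<longlonglongrightarrow> 0"
    by (rule Lim_null_comparison[OF always_eventually[OF allI[OF le]]])
  moreover have "(\<lambda>j. ?f (approach (Suc k) j) - ?f (approach 0 j)) \<longlonglongrightarrow> s k - 0"
    using tendsto_diff[OF bump_fun_approach[OF s, of "Suc k"] bump_fun_approach[OF s, of 0]] by simp
  ultimately have "0 = s k - 0" by (rule LIMSEQ_unique)
  then show "s k = 0 k" by simp
qed

end

theorem linf_in_Hinf0:
  assumes "\<exists>x::'a::complex_normed_vector. x \<noteq> 0"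
  shows "\<exists>M :: ('a \<Rightarrow> complex) set. cfun.subspace M \<and> M \<subseteq> Hinf0 \<and>
           M \<subseteq> (Hinf0 - HL0) \<union> {0} \<and> isomorphic linf linf_norm M sup_norm"
proof -
  obtain x :: 'a where "x \<noteq> 0" using assms by blast
  define x0 where "x0 = (1 / norm x) *\<^sub>R x"
  have x0: "norm x0 = 1" using \<open>x \<noteq> 0\<close> by (simp add: x0_def)
  obtain \<phi> :: "'a \<Rightarrow> complex" where "bounded_linear \<phi>" "\<And>c x. \<phi> (c *\<^sub>C x) = c * \<phi> x"
      "\<And>x. cmod (\<phi> x) \<le> norm x" "\<phi> x0 = of_real (norm x0)"
    using norming_functional[of x0] by metis
  then have "norming \<phi> x0" using x0 by (intro norming.intro) simp_all
  then interpret norming \<phi> x0 .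
  define M where "M = bump_fun \<phi> ` linf"
  have sup_le: "sup_norm (bump_fun \<phi> s) \<le> 16 * linf_norm s" if "s \<in> linf" for s
    unfolding sup_norm_def using cmod_bump_fun_le[OF that] by (intro cSUP_least) auto
  note iso = isomorphic_image[OF fun_norm_linf fun_norm_Hinf0 bump_fun_Hinf0 bump_fun_add
      bump_fun_mult sup_le _ linf_norm_le_bump_fun]
  have "M \<subseteq> Hinf0" unfolding M_def using bump_fun_Hinf0 by blast
  moreover have "bump_fun \<phi> s = 0" if "s \<in> linf" "bump_fun \<phi> s \<in> HL0" for s
  proof -
    have "s = 0" using that bump_fun_not_Lipschitz[OF that(1)] by (auto simp: HL0_def Lip0_def)
    then show ?thesis using bump_fun_mult[OF that(1), of 0] by (simp add: zero_fun_def)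
  qed
  then have "M \<subseteq> (Hinf0 - HL0) \<union> {0}" using \<open>M \<subseteq> Hinf0\<close> unfolding M_def by blast
  moreover have "cfun.subspace M" "isomorphic linf linf_norm M sup_norm"
    unfolding M_def by (rule iso; simp)+
  ultimately show ?thesis by blast
qed

section \<open>Lipschitz functions that are not holomorphic\<close>

text \<open>
  The tents below have slopes \<open>\<plusminus> 1\<close> and height \<open>center n / 4\<close>; this makes their supports disjoint, as
  \<open>5/4 \<sqdot> center (Suc n) = 5/8 \<sqdot> center n < 3/4 \<sqdot> center n\<close>.
\<close>

definition center :: "nat \<Rightarrow> real" where
  "center n = 1 / 2 ^ Suc n"

definition tent :: "nat \<Rightarrow> real \<Rightarrow> real" where
  "tent n r = max 0 (center n / 4 - \<bar>r - center n\<bar>)"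

definition tent_sum :: "(nat \<Rightarrow> complex) \<Rightarrow> real \<Rightarrow> complex" where
  "tent_sum s r = (\<Sum>n. s n * of_real (tent n r))"

lemma center_pos: "center n > 0" and center_le_half: "center n \<le> 1 / 2"
  by (simp_all add: center_def field_simps)

lemma tent_disjoint:
  assumes "m < n" "tent n r \<noteq> 0"
  shows "tent m r = 0"
proof -
  have "(2::real) ^ Suc (Suc m) \<le> 2 ^ Suc n" using assms(1) by (intro power_increasing) auto
  then have "center n \<le> center m / 2" by (simp add: center_def field_simps)
  moreover have "\<bar>r - center n\<bar> < center n / 4" using assms(2) by (simp add: tent_def max_def split: if_splits)
  ultimately have "center m / 4 - \<bar>r - center m\<bar> \<le> 0" using center_pos[of m] by linarith
  then show ?thesis by (simp add: tent_def)
qed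

lemma tent_support: "\<exists>n. \<forall>m. m \<noteq> n \<longrightarrow> tent m r = 0"
  using tent_disjoint by (metis linorder_neqE_nat)

lemma tent_sum_eq:
  assumes "\<And>m. m \<noteq> n \<Longrightarrow> tent m r = 0"
  shows "tent_sum s r = s n * of_real (tent n r)"
  unfolding tent_sum_def using suminf_finite[of "{n}" "\<lambda>n. s n * of_real (tent n r)"] assms by simp

lemma tent_sum_add: "tent_sum (s + t) r = tent_sum s r + tent_sum t r"
  and tent_sum_mult: "tent_sum (\<lambda>i. c * s i) r = c * tent_sum s r"
proof -
  obtain n where n: "\<And>m. m \<noteq> n \<Longrightarrow> tent m r = 0" using tent_support by blast
  show "tent_sum (s + t) r = tent_sum s r + tent_sum t r"
    "tent_sum (\<lambda>i. c * s i) r = c * tent_sum s r"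
    by (simp_all add: tent_sum_eq[OF n] distrib_right)
qed

lemma tent_sum_near_center:
  assumes "\<bar>h\<bar> < center n / 4"
  shows "tent_sum s (center n + h) = s n * of_real (center n / 4 - \<bar>h\<bar>)"
proof -
  have t: "tent n (center n + h) = center n / 4 - \<bar>h\<bar>" using assms by (simp add: tent_def)
  then have "tent n (center n + h) \<noteq> 0" using assms by simp
  then have "tent m (center n + h) = 0" if "m \<noteq> n" for m
    using that tent_disjoint by (metis linorder_neqE_nat)
  then show ?thesis using tent_sum_eq[of n "center n + h" s] t by simp
qed

lemma tent_lipschitz: "\<bar>tent n r - tent n r'\<bar> \<le> \<bar>r - r'\<bar>"
  unfolding tent_def by linarith

text \<open>
  At most two tents are involved. If \<open>r\<close> and \<open>r'\<close> lie under different tents, then each of these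
  tents vanishes at the other point, so that its value is itself a difference of values; this
  accounts for the factor \<open>2\<close>.
\<close>

lemma tent_sum_lipschitz:
  assumes s: "s \<in> linf"
  shows "cmod (tent_sum s r - tent_sum s r') \<le> 2 * linf_norm s * \<bar>r - r'\<bar>"
proof -
  obtain n where n: "\<And>m. m \<noteq> n \<Longrightarrow> tent m r = 0" using tent_support by blast
  obtain n' where n': "\<And>m. m \<noteq> n' \<Longrightarrow> tent m r' = 0" using tent_support by blast
  have le: "cmod (s k * of_real (tent k r - tent k r')) \<le> linf_norm s * \<bar>r - r'\<bar>" for k
    unfolding norm_mult norm_of_real
    using cmod_le_linf_norm[OF s] linf_norm_nonneg[OF s] tent_lipschitz by (intro mult_mono) auto
  have eq: "tent_sum s r = s n * of_real (tent n r)" "tent_sum s r' = s n' * of_real (tent n' r')"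
    using n n' by (auto intro: tent_sum_eq)
  show ?thesis
  proof (cases "n = n'")
    case True
    then have "tent_sum s r - tent_sum s r' = s n * of_real (tent n r - tent n r')"
      by (simp add: eq algebra_simps)
    moreover have "0 \<le> linf_norm s * \<bar>r - r'\<bar>" using linf_norm_nonneg[OF s] by simp
    ultimately show ?thesis using le[of n] by simp
  next
    case False
    then have "tent_sum s r - tent_sum s r'
        = s n * of_real (tent n r - tent n r') + s n' * of_real (tent n' r - tent n' r')"
      using n[of n'] n'[of n] by (simp add: eq)
    then have "cmod (tent_sum s r - tent_sum s r') \<le> linf_norm s * \<bar>r - r'\<bar> + linf_norm s * \<bar>r - r'\<bar>"
      using norm_triangle_le[OF add_mono[OF le[of n] le[of n']]] by simp
    then show ?thesis by simp
  qed
qed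

text \<open>
  Both \<open>\<bar>x\<bar>\<close> and \<open>\<bar>x\<bar> - x\<close> have a minimum at \<open>0\<close>, so the derivative would be \<open>0\<close> as well as \<open>1\<close>.
\<close>

lemma abs_not_differentiable_at_0: "\<not> (abs has_real_derivative D) (at 0)"
proof
  assume D: "(abs has_real_derivative D) (at 0)"
  have "D = 0"
    by (rule DERIV_local_min[OF D, of 1]) auto
  moreover have "((\<lambda>x. \<bar>x\<bar> - x) has_real_derivative D - 1) (at 0)"
    using D by (intro derivative_intros)
  then have "D - 1 = 0"
    by (rule DERIV_local_min[of _ _ _ 1]) auto
  ultimately show False by simp
qed

text \<open>
  A radial function, whose restriction to a ray is a copy of \<open>tent_sum s\<close>.
\<close>

definition tent_fun :: "(nat \<Rightarrow> complex) \<Rightarrow> 'a::complex_normed_vector \<Rightarrow> complex" where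
  "tent_fun s x = (if x \<in> ball 0 1 then tent_sum s (norm x) else 0)"

lemma tent_fun_add: "tent_fun (s + t) = tent_fun s + tent_fun t"
  and tent_fun_mult: "tent_fun (\<lambda>i. c * s i) = (\<lambda>x. c * tent_fun s x)"
  by (simp_all add: fun_eq_iff tent_fun_def tent_sum_add tent_sum_mult)

lemma tent_fun_lipschitz:
  assumes s: "s \<in> linf"
  shows "(2 * linf_norm s)-lipschitz_on (ball 0 1) (tent_fun s)"
proof (rule lipschitz_onI)
  fix x y :: 'a assume xy: "x \<in> ball 0 1" "y \<in> ball 0 1"
  have "cmod (tent_sum s (norm x) - tent_sum s (norm y)) \<le> 2 * linf_norm s * \<bar>norm x - norm y\<bar>"
    by (rule tent_sum_lipschitz[OF s])
  also have "\<dots> \<le> 2 * linf_norm s * norm (x - y)"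
    using linf_norm_nonneg[OF s] by (intro mult_left_mono norm_triangle_ineq3) auto
  finally show "dist (tent_fun s x) (tent_fun s y) \<le> 2 * linf_norm s * dist x y"
    using xy by (simp add: tent_fun_def dist_norm)
qed (use linf_norm_nonneg[OF s] in simp)

lemma tent_0: "tent n 0 = 0"
  using center_pos[of n] by (simp add: tent_def)

lemma tent_fun_Lip0:
  assumes "s \<in> linf"
  shows "tent_fun s \<in> Lip0"
proof -
  have "tent_fun s 0 = 0" by (simp add: tent_fun_def tent_sum_def tent_0)
  then show ?thesis using tent_fun_lipschitz[OF assms] by (auto simp: Lip0_def ball_fun_def tent_fun_def)
qed

lemma lipschitz_quotient_le:
  fixes f :: "'a::real_normed_vector \<Rightarrow> complex"
  assumes "L-lipschitz_on S f" "x \<in> S" "y \<in> S" "x \<noteq> y"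
  shows "cmod (f x - f y) / norm (x - y) \<le> L"
  using lipschitz_onD[OF assms(1-3)] assms(4) by (simp add: dist_norm pos_divide_le_eq)

lemma le_Lip_norm:
  assumes L: "L-lipschitz_on (ball 0 1) f" and "x \<in> ball 0 1" "y \<in> ball 0 1" "x \<noteq> y"
  shows "cmod (f x - f y) / norm (x - y) \<le> Lip_norm f"
  unfolding Lip_norm_def
proof (rule cSup_upper)
  show "bdd_above {cmod (f x - f y) / norm (x - y) |x y. x \<in> ball 0 1 \<and> y \<in> ball 0 1 \<and> x \<noteq> y}"
    using lipschitz_quotient_le[OF L] by (intro bdd_aboveI[of _ L]) blast
qed (use assms in blast)

lemma Lip_norm_le:
  fixes x0 :: "'a::complex_normed_vector" and f :: "'a \<Rightarrow> complex"
  assumes L: "L-lipschitz_on (ball 0 1) f" and x0: "norm x0 = 1"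
  shows "Lip_norm f \<le> L"
  unfolding Lip_norm_def
proof (rule cSup_least)
  have "(1/2) *\<^sub>R x0 \<in> ball 0 1" "0 \<in> ball 0 1" "(1/2) *\<^sub>R x0 \<noteq> 0"
    using x0 by auto
  then show "{cmod (f x - f y) / norm (x - y) |x y. x \<in> ball 0 1 \<and> y \<in> ball 0 1 \<and> x \<noteq> y} \<noteq> {}"
    by blast
qed (use lipschitz_quotient_le[OF L] in blast)

lemma
  fixes x0 :: "'a::complex_normed_vector"
  assumes h: "\<bar>h\<bar> < center n / 4" and x0: "norm x0 = 1"
  shows near_center_ball: "(center n + h) *\<^sub>R x0 \<in> ball 0 1"
    and tent_fun_near_center:
      "tent_fun s ((center n + h) *\<^sub>R x0) = s n * of_real (center n / 4 - \<bar>h\<bar>)"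
proof -
  have n: "norm ((center n + h) *\<^sub>R x0) = center n + h" using h x0 by simp
  then show b: "(center n + h) *\<^sub>R x0 \<in> ball 0 1"
    using h center_le_half[of n] unfolding mem_ball dist_0_norm by linarith
  show "tent_fun s ((center n + h) *\<^sub>R x0) = s n * of_real (center n / 4 - \<bar>h\<bar>)"
    unfolding tent_fun_def n using b tent_sum_near_center[OF h, of s] by simp
qed

text \<open>
  On a ray the \<open>n\<close>-th tent contributes the difference quotient \<open>\<bar>s n\<bar>\<close>.
\<close>

lemma linf_norm_le_tent_fun:
  fixes x0 :: "'a::complex_normed_vector"
  assumes s: "s \<in> linf" and x0: "norm x0 = 1"
  shows "linf_norm s \<le> Lip_norm (tent_fun s :: 'a \<Rightarrow> complex)"
proof (rule linf_norm_le)
  fix n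
  \<comment> \<open>Half way down the tent, hence inside the open support, where no other tent contributes.\<close>
  define h where "h = center n / 8"
  have h: "0 < h" "\<bar>h\<bar> < center n / 4" "\<bar>0\<bar> < center n / 4"
    using center_pos[of n] by (auto simp: h_def)
  define x y where "x = (center n + h) *\<^sub>R x0" and "y = (center n + 0) *\<^sub>R x0"
  have xy: "x - y = h *\<^sub>R x0" by (simp add: x_def y_def algebra_simps)
  then have n: "norm (x - y) = h" using h x0 by simp
  have "tent_fun s x - tent_fun s y = - s n * of_real h"
    unfolding x_def y_def tent_fun_near_center[OF h(2) x0] tent_fun_near_center[OF h(3) x0]
    using h by (simp add: algebra_simps)
  then have "cmod (tent_fun s x - tent_fun s y) / norm (x - y) = cmod (s n)"
    using h n by (simp add: norm_mult)
  moreover have "x \<in> ball 0 1" "y \<in> ball 0 1"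
    unfolding x_def y_def by (rule near_center_ball[OF h(2) x0], rule near_center_ball[OF h(3) x0])
  moreover have "x \<noteq> y" using n h by auto
  ultimately show "cmod (s n) \<le> Lip_norm (tent_fun s :: 'a \<Rightarrow> complex)"
    using le_Lip_norm[OF tent_fun_lipschitz[OF s]] by metis
qed

text \<open>
  Holomorphy fails by lack of real differentiability: along a ray the function has a kink of size
  \<open>s n\<close> at \<open>center n\<close>, and normalising it gives the absolute value near \<open>0\<close>.
\<close>

lemma tent_fun_not_holomorphic:
  fixes x0 :: "'a::complex_normed_vector"
  assumes hol: "frechet_holomorphic_on (tent_fun s :: 'a \<Rightarrow> complex) (ball 0 1)" and x0: "norm x0 = 1"
  shows "s = 0"
proof (rule ccontr)
  assume "s \<noteq> 0"
  then obtain n where n: "s n \<noteq> 0" by (auto simp: fun_eq_iff)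
  let ?g = "\<lambda>h. tent_fun s ((center n + h) *\<^sub>R x0)"
  \<comment> \<open>The affine map that turns the tent of height \<open>s n \<sqdot> center n / 4\<close> into the absolute value.\<close>
  let ?q = "\<lambda>z. center n / 4 - Re (z / s n)"
  have c: "0 < center n / 4" using center_pos by simp
  have "center n *\<^sub>R x0 \<in> ball 0 1"
    using near_center_ball[of 0 n x0] c x0 by simp
  then obtain D where D: "(tent_fun s has_derivative D) (at (center n *\<^sub>R x0))"
    using hol unfolding frechet_holomorphic_on_def by blast
  have "(?g has_derivative (\<lambda>t. D (t *\<^sub>R x0))) (at 0)"
    by (rule has_derivative_compose[where g="tent_fun s"]) (auto intro!: derivative_eq_intros D)
  then have "((\<lambda>h. ?q (?g h)) has_derivative (\<lambda>t. 0 - Re (D (t *\<^sub>R x0) / s n))) (at 0)"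
    by (intro has_derivative_diff has_derivative_const has_derivative_Re
        bounded_linear.has_derivative[OF bounded_linear_divide])
  then have "(abs has_derivative (\<lambda>t. 0 - Re (D (t *\<^sub>R x0) / s n))) (at 0)"
  proof (rule has_derivative_transform_within_open[OF _ open_ball])
    show "0 \<in> ball (0::real) (center n / 4)" using c by simp
    show "?q (?g h) = \<bar>h\<bar>" if "h \<in> ball 0 (center n / 4)" for h
      using that n tent_fun_near_center[of h n x0 s] x0 by (simp add: dist_real_def)
  qed
  then have "abs differentiable (at (0::real))" by (rule differentiableI)
  then show False by (rule real_differentiableE) (rule notE[OF abs_not_differentiable_at_0])
qed

theorem linf_in_Lip0:
  assumes "\<exists>x::'a::complex_normed_vector. x \<noteq> 0"
  shows "\<exists>M :: ('a \<Rightarrow> complex) set. cfun.subspace M \<and> M \<subseteq> Lip0 \<and>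
           M \<subseteq> (Lip0 - HL0) \<union> {0} \<and> isomorphic linf linf_norm M Lip_norm"
proof -
  obtain x :: 'a where "x \<noteq> 0" using assms by blast
  define x0 where "x0 = (1 / norm x) *\<^sub>R x"
  have x0: "norm x0 = 1" using \<open>x \<noteq> 0\<close> by (simp add: x0_def)
  define M where "M = (tent_fun :: _ \<Rightarrow> 'a \<Rightarrow> complex) ` linf"
  note iso = isomorphic_image[OF fun_norm_linf fun_norm_Lip0[OF assms] tent_fun_Lip0 tent_fun_add
      tent_fun_mult Lip_norm_le[OF tent_fun_lipschitz x0] _ linf_norm_le_tent_fun[OF _ x0]]
  have "M \<subseteq> Lip0" unfolding M_def using tent_fun_Lip0 by blast
  moreover have "tent_fun s = (0 :: 'a \<Rightarrow> complex)" if "tent_fun s \<in> (HL0 :: ('a \<Rightarrow> complex) set)" for s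
  proof -
    have "s = 0" using that tent_fun_not_holomorphic[OF _ x0] by (auto simp: HL0_def Hinf0_def)
    then show ?thesis using tent_fun_mult[of 0 0] by (simp add: zero_fun_def)
  qed
  then have "M \<subseteq> (Lip0 - HL0) \<union> {0}" using \<open>M \<subseteq> Lip0\<close> unfolding M_def by blast
  moreover have "cfun.subspace M" "isomorphic linf linf_norm M Lip_norm"
    unfolding M_def by (rule iso; simp)+
  ultimately show ?thesis by blast
qed

section \<open>The two embeddings of bounded sequences\<close>

theorem theorem2p4:
  assumes "\<exists>x::'a::complex_banach. x \<noteq> 0"
  shows "(\<exists>M :: ('a \<Rightarrow> complex) set. cfun.subspace M \<and> M \<subseteq> Hinf0 \<and>
             M \<subseteq> (Hinf0 - HL0) \<union> {0} \<and> isomorphic linf linf_norm M sup_norm) \<and>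
         (\<exists>M :: ('a \<Rightarrow> complex) set. cfun.subspace M \<and> M \<subseteq> Lip0 \<and>
             M \<subseteq> (Lip0 - HL0) \<union> {0} \<and> isomorphic linf linf_norm M Lip_norm)"
  using linf_in_Hinf0[OF assms] linf_in_Lip0[OF assms] by (rule conjI)

end
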